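(* Let $(M,\boldsymbol{c},\sigma)$ be an almost Riemannian manifold, and let $\mathcal{Z}(\sigma)$ be the zero locus of $\sigma$. Suppose that $\gamma$ is a smooth unparametrised curve on $M$ that is a geodesic for $g=\sigma^{-2}\mathbf{g}$ on $M\setminus\mathcal{Z}(\sigma)$. Then $\gamma$ is a generalised geodesic of $(M,\boldsymbol{c},\sigma)$.
   Context: Conventions. Manifolds (possibly with boundary) are smooth, connected, of dimension $n\ge3$; $\boldsymbol{c}$ is a conformal class of metrics. Abstract indices are used: $\mathcal{E}^a=TM$, $\mathcal{E}_a=T^*M$; square brackets around indices denote the completely antisymmetric part. Density bundles: $\mathcal{E}[w]=\big((\Lambda^nTM)^{2}\big)^{w/2n}$ for $w\in\mathbb{R}$, $\mathcal{E}_+[1]$ is the bundle of positive 1-densities, and $\mathcal{V}[w]=\mathcal{V}\otimes\mathcal{E}[w]$. The conformal metric $\mathbf{g}_{ab}\in\Gamma(\mathcal{E}_{(ab)}[2])$ is characterised by: each $g\in\boldsymbol{c}$ is $\sigma_g^{-2}\mathbf{g}$ for a unique $\sigma_g\in\Gamma(\mathcal{E}_+[1])$. Indices are raised and lowered with $\mathbf{g}$; the Levi-Civita connection $\nabla$ of $g\in\boldsymbol{c}$ acts on densities and preserves $\mathbf{g}$ and $\sigma_g$. $P_{ab}=\frac{1}{n-2}(\mathrm{Ric}_{ab}-J\mathbf{g}_{ab})$ is the Schouten tensor of $g$, $J=\mathbf{g}^{ab}P_{ab}$, $\Delta=\mathbf{g}^{ab}\nabla_a\nabla_b$. Tractors.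 The standard tractor bundle $\mathcal{T}$ is the rank $n+2$ bundle which, for each $g\in\boldsymbol{c}$, is identified with $\mathcal{E}[1]\oplus\mathcal{E}_a[1]\oplus\mathcal{E}[-1]$; for $\hat g=e^{2\omega}g$, $\Upsilon=d\omega$, the triples are related by $(\hat\sigma,\hat\mu_a,\hat\rho)=(\sigma,\ \mu_a+\Upsilon_a\sigma,\ \rho-\Upsilon^b\mu_b-\tfrac12\Upsilon^b\Upsilon_b\sigma)$. In a scale $g$ write $V^A=\sigma Y^A+\mu^aZ^A{}_a+\rho X^A$ for the triple $(\sigma,\mu_a,\rho)$; $X^A\in\Gamma(\mathcal{E}^A[1])$ is conformally invariant. The tractor connection is $\nabla_a(\sigma,\mu_b,\rho)=(\nabla_a\sigma-\mu_a,\ \nabla_a\mu_b+\mathbf{g}_{ab}\rho+P_{ab}\sigma,\ \nabla_a\rho-P_{ab}\mu^b)$. Scale tractor of $\sigma\in\Gamma(\mathcal{E}[1])$: $I=\big(\sigma,\ \nabla_a\sigma,\ -\tfrac1n(\Delta\sigma+J\sigma)\big)\in\Gamma(\mathcal{T})$ (conformally invariant). $(M,\boldsymbol{c},\sigma)$, with $\sigma\in\Gamma(\mathcal{E}[1])$, is an almost pseudo-Riemannian manifold if $I$ is nowhere zero (then $M\setminus\mathcal{Z}(\sigma)$ is open and dense in $M$ and carries the metric $\sigma^{-2}\mathbf{g}$); it is almost Riemannian if moreover $\boldsymbol{c}$ has Riemannian signature. Curves. A curve is a smooth regular map from an interval to $M$. A curve with velocity $u^a$ is an unparametrised geodesic of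 a metric if $u^a\nabla_au^b\propto u^b$ for the Levi-Civita connection $\nabla$ of that metric. For a nowhere-null curve with velocity $u^a$ put $\sigma_u=\sqrt{\pm\mathbf{g}_{ab}u^au^b}$ ($+$ if spacelike, $-$ if timelike), weighted velocity $\mathbf{u}^a=\sigma_u^{-1}u^a$, and, in a scale $g$, weighted acceleration $\mathbf{a}^b=\mathbf{u}^a\nabla_a\mathbf{u}^b$. With $U^A=\sigma_u\mathbf{u}^a\nabla_a(\sigma_u^{-1}X^A)$ and $A^B=\sigma_u\mathbf{u}^a\nabla_aU^B$, the 3-tractor of $\gamma$ is $$\Sigma^{ABC}=6\sigma_u^{-1}X^{[A}U^BA^{C]}=\pm6\,\mathbf{u}^cX^{[A}Y^BZ^{C]}{}_c+6\,\mathbf{u}^b\mathbf{a}^cX^{[A}Z^B{}_bZ^{C]}{}_c ,$$ which is conformally invariant and parametrisation independent. Generalised geodesic of an almost pseudo-Riemannian manifold $(M,\boldsymbol{c},\sigma)$: an unparametrised (nowhere-null) curve $\gamma$ in $M$ with $I\wedge\Sigma=0$ along $\gamma$, where $I\wedge\Sigma:=I^{[A}\Sigma^{BCD]}$.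
   Formalization: Added hypothesis: the part of γ lying in M∖Z(σ) is dense along γ (no segment of γ lies in Z(σ)); without it the claim fails, e.g. for any curve inside {x₁=0} in flat space with σ=x₁, where the geodesic condition is vacuous. *)

theory Defs
  imports "HOL-Analysis.Analysis"
begin

section \<open>Smooth manifolds with boundary\<close>

text \<open>Smoothness uses derivatives relative to the set \<open>S\<close>. It is only applied to intervals and to
  relatively open subsets of a half-space, where these derivatives are unique and where the
  condition agrees with the existence of local smooth extensions.\<close>

primrec Ck_on :: "nat \<Rightarrow> 'a::euclidean_space set \<Rightarrow> ('a \<Rightarrow> 'b::real_normed_vector) \<Rightarrow> bool" where
  "Ck_on 0 S f \<longleftrightarrow> continuous_on S f"
| "Ck_on (Suc k) S f \<longleftrightarrow> f differentiable_on S \<and>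
     (\<forall>b\<in>Basis. Ck_on k S (\<lambda>x. frechet_derivative f (at x within S) b))"

definition smooth_on :: "'a::euclidean_space set \<Rightarrow> ('a \<Rightarrow> 'b::real_normed_vector) \<Rightarrow> bool" where
  "smooth_on S f \<longleftrightarrow> (\<forall>k. Ck_on k S f)"

datatype ('m, 'n::finite) chart = Chart (dom: "'m set") (coord: "'m \<Rightarrow> real^'n")

definition img :: "('m, 'n::finite) chart \<Rightarrow> (real^'n) set" where
  "img \<phi> = coord \<phi> ` dom \<phi>"

definition param :: "('m, 'n::finite) chart \<Rightarrow> real^'n \<Rightarrow> 'm" where
  "param \<phi> = inv_into (dom \<phi>) (coord \<phi>)"

definition chart_on :: "'m topology \<Rightarrow> ('m, 'n::finite) chart \<Rightarrow> bool" where
  "chart_on M \<phi> \<longleftrightarrow> openin M (dom \<phi>) \<and>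
     (open (img \<phi>) \<or> (\<exists>k. openin (top_of_set {x. 0 \<le> x $ k}) (img \<phi>))) \<and>
     homeomorphic_map (subtopology M (dom \<phi>)) (top_of_set (img \<phi>)) (coord \<phi>)"

text \<open>The atlas \<open>A\<close> need not be maximal: every notion below that quantifies over the charts of \<open>A\<close>
  is invariant under smooth changes of coordinates.\<close>

definition manifold_with_boundary :: "'m topology \<Rightarrow> ('m, 'n::finite) chart set \<Rightarrow> bool" where
  "manifold_with_boundary M A \<longleftrightarrow>
     Hausdorff_space M \<and> second_countable M \<and> connected_space M \<and>
     (\<forall>\<phi>\<in>A. chart_on M \<phi>) \<and> (\<Union>\<phi>\<in>A. dom \<phi>) = topspace M \<and>
     (\<forall>\<phi>\<in>A. \<forall>\<psi>\<in>A. smooth_on (coord \<phi> ` (dom \<phi> \<inter> dom \<psi>)) (coord \<psi> \<circ> param \<phi>))"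

definition smooth_function ::
  "('m, 'n::finite) chart set \<Rightarrow> ('m \<Rightarrow> real) \<Rightarrow> bool" where
  "smooth_function A f \<longleftrightarrow> (\<forall>\<phi>\<in>A. smooth_on (img \<phi>) (f \<circ> param \<phi>))"

text \<open>Row \<open>i\<close>, column \<open>j\<close> of the Jacobian at \<open>p\<close> is the derivative of the \<open>i\<close>-th coordinate of
  \<open>\<psi>\<close> with respect to the \<open>j\<close>-th coordinate of \<open>\<phi>\<close>.\<close>

definition jacobian_at ::
  "('m, 'n::finite) chart \<Rightarrow> ('m, 'n) chart \<Rightarrow> 'm \<Rightarrow> real^'n^'n" where
  "jacobian_at \<phi> \<psi> p =
     matrix (frechet_derivative (coord \<psi> \<circ> param \<phi>)
       (at (coord \<phi> p) within coord \<phi> ` (dom \<phi> \<inter> dom \<psi>)))"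

definition pd :: "('m, 'n::finite) chart \<Rightarrow> 'n \<Rightarrow> ('m \<Rightarrow> real) \<Rightarrow> 'm \<Rightarrow> real" where
  "pd \<phi> i f p =
     frechet_derivative (f \<circ> param \<phi>) (at (coord \<phi> p) within img \<phi>) (axis i 1)"

section \<open>Metrics, densities and conformal classes\<close>

text \<open>A tensor field or density is a family of component functions, one for each chart of the atlas,
  subject to the transformation law. Values at points outside the domain of the chart are
  irrelevant.\<close>

type_synonym ('m, 'n) metric_field = "('m, 'n) chart \<Rightarrow> 'm \<Rightarrow> real^'n^'n"
type_synonym ('m, 'n) density_field = "('m, 'n) chart \<Rightarrow> 'm \<Rightarrow> real"

definition pseudo_riemannian_metric ::
  "('m, 'n::finite) chart set \<Rightarrow> ('m, 'n) metric_field \<Rightarrow> bool" where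
  "pseudo_riemannian_metric A g \<longleftrightarrow>
     (\<forall>\<phi>\<in>A. smooth_on (img \<phi>) (g \<phi> \<circ> param \<phi>)) \<and>
     (\<forall>\<phi>\<in>A. \<forall>p\<in>dom \<phi>. transpose (g \<phi> p) = g \<phi> p \<and> det (g \<phi> p) \<noteq> 0) \<and>
     (\<forall>\<phi>\<in>A. \<forall>\<psi>\<in>A. \<forall>p\<in>dom \<phi> \<inter> dom \<psi>.
        g \<phi> p = transpose (jacobian_at \<phi> \<psi> p) ** g \<psi> p ** jacobian_at \<phi> \<psi> p)"

definition positive_definite ::
  "('m, 'n::finite) chart set \<Rightarrow> ('m, 'n) metric_field \<Rightarrow> bool" where
  "positive_definite A g \<longleftrightarrow>
     (\<forall>\<phi>\<in>A. \<forall>p\<in>dom \<phi>. \<forall>v. v \<noteq> 0 \<longrightarrow> v \<bullet> (g \<phi> p *v v) > 0)"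

definition conformal_class ::
  "('m, 'n::finite) chart set \<Rightarrow> ('m, 'n) metric_field set \<Rightarrow> bool" where
  "conformal_class A c \<longleftrightarrow> (\<exists>g0. pseudo_riemannian_metric A g0 \<and>
     c = {g. \<exists>\<omega>. smooth_function A \<omega> \<and>
            (\<forall>\<phi>\<in>A. \<forall>p\<in>dom \<phi>. g \<phi> p = exp (2 * \<omega> p) *\<^sub>R g0 \<phi> p)})"

text \<open>A section of \<open>((\<Lambda>\<^sup>n TM)\<^sup>2)\<^bsup>w/2n\<^esup>\<close> has in the chart \<open>\<phi>\<close> the component with respect to
  the positive section \<open>((\<partial>\<^sub>1 \<and> \<dots> \<and> \<partial>\<^sub>n)\<^sup>2)\<^bsup>w/2n\<^esup>\<close>, where \<open>\<partial>\<^sub>i\<close> are the coordinate vector fields.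
  Below, components of all weighted objects refer to this trivialisation.\<close>

definition density_section ::
  "('m, 'n::finite) chart set \<Rightarrow> real \<Rightarrow> ('m, 'n) density_field \<Rightarrow> bool" where
  "density_section A w s \<longleftrightarrow>
     (\<forall>\<phi>\<in>A. smooth_on (img \<phi>) (s \<phi> \<circ> param \<phi>)) \<and>
     (\<forall>\<phi>\<in>A. \<forall>\<psi>\<in>A. \<forall>p\<in>dom \<phi> \<inter> dom \<psi>.
        s \<psi> p = \<bar>det (jacobian_at \<phi> \<psi> p)\<bar> powr (w / real CARD('n)) * s \<phi> p)"

definition zero_locus ::
  "'m topology \<Rightarrow> ('m, 'n::finite) chart set \<Rightarrow> ('m, 'n) density_field \<Rightarrow> 'm set" where
  "zero_locus M A s = {p \<in> topspace M. \<forall>\<phi>\<in>A. p \<in> dom \<phi> \<longrightarrow> s \<phi> p = 0}"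

text \<open>The scale \<open>\<sigma>\<^sub>g\<close> of \<open>g\<close> has the component \<open>\<bar>det g\<bar>\<^bsup>-1/2n\<^esup>\<close>, so that the conformal metric
  \<open>\<sigma>\<^sub>g\<^sup>2 g\<close> has determinant \<open>\<plusminus>1\<close> in every chart; it does not depend on the choice of \<open>g\<close> in \<open>c\<close>.\<close>

definition scale_density :: "('m, 'n::finite) metric_field \<Rightarrow> ('m, 'n) density_field" where
  "scale_density g \<phi> p = \<bar>det (g \<phi> p)\<bar> powr (- 1 / (2 * real CARD('n)))"

definition conf_metric ::
  "('m, 'n::finite) metric_field set \<Rightarrow> ('m, 'n) metric_field" where
  "conf_metric c \<phi> p = (let g = (SOME g. g \<in> c) in (scale_density g \<phi> p)\<^sup>2 *\<^sub>R g \<phi> p)"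

text \<open>The metric \<open>\<sigma>\<^sup>-\<^sup>2\<close> times the conformal metric; meaningful off the zero locus of \<open>\<sigma>\<close>.\<close>

definition singular_metric ::
  "('m, 'n::finite) metric_field set \<Rightarrow> ('m, 'n) density_field \<Rightarrow> ('m, 'n) metric_field" where
  "singular_metric c \<sigma> \<phi> p = inverse ((\<sigma> \<phi> p)\<^sup>2) *\<^sub>R conf_metric c \<phi> p"

definition conf_inv ::
  "('m, 'n::finite) metric_field set \<Rightarrow> ('m, 'n) chart \<Rightarrow> 'n \<Rightarrow> 'n \<Rightarrow> 'm \<Rightarrow> real" where
  "conf_inv c \<phi> i j p = matrix_inv (conf_metric c \<phi> p) $ i $ j"

section \<open>Levi-Civita connection and curvature\<close>

text \<open>\<open>christoffel g \<phi> k i j\<close> is \<open>\<Gamma>\<close> with upper index \<open>k\<close> and lower indices \<open>i\<close>, \<open>j\<close>.\<close>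

definition christoffel ::
  "('m, 'n::finite) metric_field \<Rightarrow> ('m, 'n) chart \<Rightarrow> 'n \<Rightarrow> 'n \<Rightarrow> 'n \<Rightarrow> 'm \<Rightarrow> real" where
  "christoffel g \<phi> k i j p = (1/2) * (\<Sum>l\<in>UNIV. matrix_inv (g \<phi> p) $ k $ l *
     (pd \<phi> i (\<lambda>q. g \<phi> q $ j $ l) p + pd \<phi> j (\<lambda>q. g \<phi> q $ i $ l) p
       - pd \<phi> l (\<lambda>q. g \<phi> q $ i $ j) p))"

definition christoffel_trace ::
  "('m, 'n::finite) metric_field \<Rightarrow> ('m, 'n) chart \<Rightarrow> 'n \<Rightarrow> 'm \<Rightarrow> real" where
  "christoffel_trace g \<phi> i p = (\<Sum>k\<in>UNIV. christoffel g \<phi> k i k p)"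

text \<open>Sign convention: round spheres have positive Ricci tensor.\<close>

definition ricci ::
  "('m, 'n::finite) metric_field \<Rightarrow> ('m, 'n) chart \<Rightarrow> 'n \<Rightarrow> 'n \<Rightarrow> 'm \<Rightarrow> real" where
  "ricci g \<phi> i j p =
     (\<Sum>k\<in>UNIV. pd \<phi> k (christoffel g \<phi> k i j) p - pd \<phi> j (christoffel g \<phi> k i k) p)
     + (\<Sum>k\<in>UNIV. \<Sum>l\<in>UNIV. christoffel g \<phi> k k l p * christoffel g \<phi> l i j p
          - christoffel g \<phi> k j l p * christoffel g \<phi> l i k p)"

text \<open>Tracing \<open>(n - 2) P = Ric - J \<cdot> (conformal metric)\<close> with \<open>J = tr P\<close> gives
  \<open>tr Ric = 2 (n - 1) J\<close>.\<close>

definition schouten_trace ::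
  "('m, 'n::finite) metric_field set \<Rightarrow> ('m, 'n) metric_field \<Rightarrow> ('m, 'n) chart \<Rightarrow> 'm \<Rightarrow> real" where
  "schouten_trace c g \<phi> p =
     (\<Sum>i\<in>UNIV. \<Sum>j\<in>UNIV. conf_inv c \<phi> i j p * ricci g \<phi> i j p) / (2 * (real CARD('n) - 1))"

definition schouten ::
  "('m, 'n::finite) metric_field set \<Rightarrow> ('m, 'n) metric_field \<Rightarrow> ('m, 'n) chart \<Rightarrow>
     'n \<Rightarrow> 'n \<Rightarrow> 'm \<Rightarrow> real" where
  "schouten c g \<phi> i j p =
     (ricci g \<phi> i j p - schouten_trace c g \<phi> p * conf_metric c \<phi> p $ i $ j) / (real CARD('n) - 2)"

text \<open>Covariant derivatives, in direction \<open>i\<close>, of densities and of the \<open>j\<close>-component of 1-forms of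
  weight \<open>w\<close>. The weight term comes from the action of the connection on
  \<open>\<partial>\<^sub>1 \<and> \<dots> \<and> \<partial>\<^sub>n\<close>.\<close>

definition nabla_density ::
  "real \<Rightarrow> ('m, 'n::finite) metric_field \<Rightarrow> ('m, 'n) chart \<Rightarrow> ('m \<Rightarrow> real) \<Rightarrow>
     'n \<Rightarrow> 'm \<Rightarrow> real" where
  "nabla_density w g \<phi> s i p =
     pd \<phi> i s p + w / real CARD('n) * christoffel_trace g \<phi> i p * s p"

definition nabla_form ::
  "real \<Rightarrow> ('m, 'n::finite) metric_field \<Rightarrow> ('m, 'n) chart \<Rightarrow> ('n \<Rightarrow> 'm \<Rightarrow> real) \<Rightarrow>
     'n \<Rightarrow> 'n \<Rightarrow> 'm \<Rightarrow> real" where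
  "nabla_form w g \<phi> \<mu> i j p =
     pd \<phi> i (\<mu> j) p - (\<Sum>k\<in>UNIV. christoffel g \<phi> k i j p * \<mu> k p)
     + w / real CARD('n) * christoffel_trace g \<phi> i p * \<mu> j p"

definition laplacian_density ::
  "real \<Rightarrow> ('m, 'n::finite) metric_field set \<Rightarrow> ('m, 'n) metric_field \<Rightarrow> ('m, 'n) chart \<Rightarrow>
     ('m \<Rightarrow> real) \<Rightarrow> 'm \<Rightarrow> real" where
  "laplacian_density w c g \<phi> s p =
     (\<Sum>i\<in>UNIV. \<Sum>j\<in>UNIV. conf_inv c \<phi> i j p * nabla_form w g \<phi> (nabla_density w g \<phi> s) i j p)"

section \<open>Tractors\<close>

text \<open>A tractor at \<open>p\<close> is given, in each chart \<open>\<phi>\<close> around \<open>p\<close> and each scale \<open>g \<in> c\<close>, by the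
  components of its triple \<open>(\<sigma>, \<mu>\<^sub>a, \<rho>)\<close>. The change of triple between scales and charts is linear and
  invertible, so (non)vanishing does not depend on \<open>\<phi>\<close> and \<open>g\<close>.\<close>

type_synonym 'n tractor = "real \<times> (real^'n) \<times> real"

definition scale_tractor ::
  "('m, 'n::finite) metric_field set \<Rightarrow> ('m, 'n) density_field \<Rightarrow>
     ('m, 'n) metric_field \<Rightarrow> ('m, 'n) chart \<Rightarrow> 'm \<Rightarrow> 'n tractor" where
  "scale_tractor c \<sigma> g \<phi> p =
     (\<sigma> \<phi> p,
      \<chi> i. nabla_density 1 g \<phi> (\<sigma> \<phi>) i p,
      - (laplacian_density 1 c g \<phi> (\<sigma> \<phi>) p + schouten_trace c g \<phi> p * \<sigma> \<phi> p) / real CARD('n))"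

definition almost_pseudo_riemannian ::
  "'m topology \<Rightarrow> ('m, 'n::finite) chart set \<Rightarrow> ('m, 'n) metric_field set \<Rightarrow>
     ('m, 'n) density_field \<Rightarrow> bool" where
  "almost_pseudo_riemannian M A c \<sigma> \<longleftrightarrow>
     manifold_with_boundary M A \<and> conformal_class A c \<and> density_section A 1 \<sigma> \<and>
     (\<forall>\<phi>\<in>A. \<forall>g\<in>c. \<forall>p\<in>dom \<phi>. scale_tractor c \<sigma> g \<phi> p \<noteq> 0)"

definition almost_riemannian ::
  "'m topology \<Rightarrow> ('m, 'n::finite) chart set \<Rightarrow> ('m, 'n) metric_field set \<Rightarrow>
     ('m, 'n) density_field \<Rightarrow> bool" where
  "almost_riemannian M A c \<sigma> \<longleftrightarrow>
     almost_pseudo_riemannian M A c \<sigma> \<and> (\<forall>g\<in>c. positive_definite A g)"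

section \<open>Curves\<close>

text \<open>An unparametrised curve is represented by any of its regular parametrisations
  \<open>\<gamma> : J \<rightarrow> M\<close>; the notions of geodesic and of generalised geodesic do not depend on it.\<close>

definition velocity ::
  "('m, 'n::finite) chart \<Rightarrow> real set \<Rightarrow> (real \<Rightarrow> 'm) \<Rightarrow> real \<Rightarrow> real^'n" where
  "velocity \<phi> J \<gamma> t = vector_derivative (coord \<phi> \<circ> \<gamma>) (at t within J)"

definition smooth_curve ::
  "'m topology \<Rightarrow> ('m, 'n::finite) chart set \<Rightarrow> real set \<Rightarrow> (real \<Rightarrow> 'm) \<Rightarrow> bool" where
  "smooth_curve M A J \<gamma> \<longleftrightarrow>
     is_interval J \<and> interior J \<noteq> {} \<and> continuous_map (top_of_set J) M \<gamma> \<and>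
     (\<forall>\<phi>\<in>A. smooth_on {t \<in> J. \<gamma> t \<in> dom \<phi>} (coord \<phi> \<circ> \<gamma>)) \<and>
     (\<forall>\<phi>\<in>A. \<forall>t\<in>J. \<gamma> t \<in> dom \<phi> \<longrightarrow> velocity \<phi> J \<gamma> t \<noteq> 0)"

text \<open>The acceleration of \<open>\<gamma>\<close> for the Levi-Civita connection of \<open>h\<close>.\<close>

definition acceleration ::
  "('m, 'n::finite) metric_field \<Rightarrow> ('m, 'n) chart \<Rightarrow> real set \<Rightarrow> (real \<Rightarrow> 'm) \<Rightarrow>
     real \<Rightarrow> real^'n" where
  "acceleration h \<phi> J \<gamma> t =
     vector_derivative (velocity \<phi> J \<gamma>) (at t within J) +
     (\<chi> k. \<Sum>i\<in>UNIV. \<Sum>j\<in>UNIV. christoffel h \<phi> k i j (\<gamma> t) *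
        velocity \<phi> J \<gamma> t $ i * velocity \<phi> J \<gamma> t $ j)"

text \<open>No condition is imposed where \<open>\<gamma>\<close> is outside \<open>W\<close>; in particular a curve that avoids \<open>W\<close>
  satisfies this vacuously.\<close>

definition unparam_geodesic_on ::
  "('m, 'n::finite) chart set \<Rightarrow> 'm set \<Rightarrow> ('m, 'n) metric_field \<Rightarrow>
     real set \<Rightarrow> (real \<Rightarrow> 'm) \<Rightarrow> bool" where
  "unparam_geodesic_on A W h J \<gamma> \<longleftrightarrow>
     (\<forall>\<phi>\<in>A. \<forall>t\<in>J. \<gamma> t \<in> W \<inter> dom \<phi> \<longrightarrow>
        (\<exists>k. acceleration h \<phi> J \<gamma> t = k *\<^sub>R velocity \<phi> J \<gamma> t))"

definition nowhere_null ::
  "('m, 'n::finite) chart set \<Rightarrow> ('m, 'n) metric_field set \<Rightarrow> real set \<Rightarrow> (real \<Rightarrow> 'm) \<Rightarrow> bool" where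
  "nowhere_null A c J \<gamma> \<longleftrightarrow>
     (\<forall>\<phi>\<in>A. \<forall>t\<in>J. \<gamma> t \<in> dom \<phi> \<longrightarrow>
        velocity \<phi> J \<gamma> t \<bullet> (conf_metric c \<phi> (\<gamma> t) *v velocity \<phi> J \<gamma> t) \<noteq> 0)"

text \<open>The absolute value implements the sign (\<open>+\<close> spacelike, \<open>-\<close> timelike).\<close>

definition sigma_u ::
  "('m, 'n::finite) metric_field set \<Rightarrow> ('m, 'n) chart \<Rightarrow> real set \<Rightarrow> (real \<Rightarrow> 'm) \<Rightarrow>
     real \<Rightarrow> real" where
  "sigma_u c \<phi> J \<gamma> t =
     sqrt \<bar>velocity \<phi> J \<gamma> t \<bullet> (conf_metric c \<phi> (\<gamma> t) *v velocity \<phi> J \<gamma> t)\<bar>"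

text \<open>\<open>u\<^sup>a \<nabla>\<^sub>a\<close> on densities and 1-forms of weight \<open>w\<close> along \<open>\<gamma>\<close>.\<close>

definition curve_nabla_density ::
  "real \<Rightarrow> ('m, 'n::finite) metric_field \<Rightarrow> ('m, 'n) chart \<Rightarrow> real set \<Rightarrow> (real \<Rightarrow> 'm) \<Rightarrow>
     (real \<Rightarrow> real) \<Rightarrow> real \<Rightarrow> real" where
  "curve_nabla_density w g \<phi> J \<gamma> s t =
     vector_derivative s (at t within J) +
     w / real CARD('n) * (\<Sum>i\<in>UNIV. velocity \<phi> J \<gamma> t $ i * christoffel_trace g \<phi> i (\<gamma> t)) * s t"

definition curve_nabla_form ::
  "real \<Rightarrow> ('m, 'n::finite) metric_field \<Rightarrow> ('m, 'n) chart \<Rightarrow> real set \<Rightarrow> (real \<Rightarrow> 'm) \<Rightarrow>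
     (real \<Rightarrow> real^'n) \<Rightarrow> real \<Rightarrow> real^'n" where
  "curve_nabla_form w g \<phi> J \<gamma> \<mu> t =
     vector_derivative \<mu> (at t within J)
     - (\<chi> j. \<Sum>i\<in>UNIV. \<Sum>k\<in>UNIV.
          christoffel g \<phi> k i j (\<gamma> t) * velocity \<phi> J \<gamma> t $ i * \<mu> t $ k)
     + (w / real CARD('n) * (\<Sum>i\<in>UNIV. velocity \<phi> J \<gamma> t $ i * christoffel_trace g \<phi> i (\<gamma> t)))
         *\<^sub>R \<mu> t"

text \<open>\<open>u\<^sup>a \<nabla>\<^sub>a\<close> for the tractor connection on unweighted tractors along \<open>\<gamma>\<close>.\<close>

definition tractor_nabla ::
  "('m, 'n::finite) metric_field set \<Rightarrow> ('m, 'n) metric_field \<Rightarrow> ('m, 'n) chart \<Rightarrow>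
     real set \<Rightarrow> (real \<Rightarrow> 'm) \<Rightarrow> (real \<Rightarrow> 'n tractor) \<Rightarrow> real \<Rightarrow> 'n tractor" where
  "tractor_nabla c g \<phi> J \<gamma> V t =
     (let u = velocity \<phi> J \<gamma> t; p = \<gamma> t;
          s = (\<lambda>r. fst (V r)); \<mu> = (\<lambda>r. fst (snd (V r))); \<rho> = (\<lambda>r. snd (snd (V r)));
          P = (\<chi> i j. schouten c g \<phi> i j p)
      in (curve_nabla_density 1 g \<phi> J \<gamma> s t - u \<bullet> \<mu> t,
          curve_nabla_form 1 g \<phi> J \<gamma> \<mu> t + \<rho> t *\<^sub>R (u v* conf_metric c \<phi> p) + s t *\<^sub>R (u v* P),
          curve_nabla_density (-1) g \<phi> J \<gamma> \<rho> t - u \<bullet> (P *v (matrix_inv (conf_metric c \<phi> p) *v \<mu> t))))"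

text \<open>The derivative along the weighted velocity \<open>\<sigma>\<^sub>u\<^sup>-\<^sup>1 u\<^sup>a\<close>.\<close>

definition weighted_tractor_nabla ::
  "('m, 'n::finite) metric_field set \<Rightarrow> ('m, 'n) metric_field \<Rightarrow> ('m, 'n) chart \<Rightarrow>
     real set \<Rightarrow> (real \<Rightarrow> 'm) \<Rightarrow> (real \<Rightarrow> 'n tractor) \<Rightarrow> real \<Rightarrow> 'n tractor" where
  "weighted_tractor_nabla c g \<phi> J \<gamma> V t =
     inverse (sigma_u c \<phi> J \<gamma> t) *\<^sub>R tractor_nabla c g \<phi> J \<gamma> V t"

definition X_tractor :: "'n::finite tractor" where
  "X_tractor = (0, 0, 1)"

definition U_tractor ::
  "('m, 'n::finite) metric_field set \<Rightarrow> ('m, 'n) metric_field \<Rightarrow> ('m, 'n) chart \<Rightarrow>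
     real set \<Rightarrow> (real \<Rightarrow> 'm) \<Rightarrow> real \<Rightarrow> 'n tractor" where
  "U_tractor c g \<phi> J \<gamma> t = sigma_u c \<phi> J \<gamma> t *\<^sub>R
     weighted_tractor_nabla c g \<phi> J \<gamma> (\<lambda>r. inverse (sigma_u c \<phi> J \<gamma> r) *\<^sub>R X_tractor) t"

definition A_tractor ::
  "('m, 'n::finite) metric_field set \<Rightarrow> ('m, 'n) metric_field \<Rightarrow> ('m, 'n) chart \<Rightarrow>
     real set \<Rightarrow> (real \<Rightarrow> 'm) \<Rightarrow> real \<Rightarrow> 'n tractor" where
  "A_tractor c g \<phi> J \<gamma> t = sigma_u c \<phi> J \<gamma> t *\<^sub>R
     weighted_tractor_nabla c g \<phi> J \<gamma> (U_tractor c g \<phi> J \<gamma>) t"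

section \<open>Generalised geodesics\<close>

text \<open>Components of \<open>\<sigma> Y\<^sup>A + \<mu>\<^sub>a Z\<^sup>A\<^sup>a + \<rho> X\<^sup>A\<close>: the index \<open>ZI a\<close> selects \<open>\<mu>\<^sub>a\<close>, with lower index.\<close>

datatype 'n tractor_index = YI | ZI 'n | XI

fun component :: "'n::finite tractor \<Rightarrow> 'n tractor_index \<Rightarrow> real" where
  "component (s, \<mu>, \<rho>) YI = s"
| "component (s, \<mu>, \<rho>) (ZI a) = \<mu> $ a"
| "component (s, \<mu>, \<rho>) XI = \<rho>"

text \<open>A tensor of rank \<open>k\<close> is a function of index assignments \<open>i\<close> which depends only on
  \<open>i 0, \<dots>, i (k - 1)\<close>; \<open>antisym k\<close> is the antisymmetric part (projection, with factor \<open>1/k!\<close>).\<close>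

definition antisym :: "nat \<Rightarrow> ((nat \<Rightarrow> 'i) \<Rightarrow> real) \<Rightarrow> (nat \<Rightarrow> 'i) \<Rightarrow> real" where
  "antisym k T i = (\<Sum>\<pi> | \<pi> permutes {..<k}. of_int (sign \<pi>) * T (i \<circ> \<pi>)) / fact k"

definition three_tractor ::
  "('m, 'n::finite) metric_field set \<Rightarrow> ('m, 'n) metric_field \<Rightarrow> ('m, 'n) chart \<Rightarrow>
     real set \<Rightarrow> (real \<Rightarrow> 'm) \<Rightarrow> real \<Rightarrow> (nat \<Rightarrow> 'n tractor_index) \<Rightarrow> real" where
  "three_tractor c g \<phi> J \<gamma> t i = 6 * inverse (sigma_u c \<phi> J \<gamma> t) *
     antisym 3 (\<lambda>i. component X_tractor (i 0) * component (U_tractor c g \<phi> J \<gamma> t) (i 1)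
                     * component (A_tractor c g \<phi> J \<gamma> t) (i 2)) i"

definition wedge_I_Sigma ::
  "('m, 'n::finite) metric_field set \<Rightarrow> ('m, 'n) density_field \<Rightarrow> ('m, 'n) metric_field \<Rightarrow>
     ('m, 'n) chart \<Rightarrow> real set \<Rightarrow> (real \<Rightarrow> 'm) \<Rightarrow> real \<Rightarrow> (nat \<Rightarrow> 'n tractor_index) \<Rightarrow> real" where
  "wedge_I_Sigma c \<sigma> g \<phi> J \<gamma> t =
     antisym 4 (\<lambda>i. component (scale_tractor c \<sigma> g \<phi> (\<gamma> t)) (i 0)
                     * three_tractor c g \<phi> J \<gamma> t (i \<circ> Suc))"

definition generalised_geodesic ::
  "'m topology \<Rightarrow> ('m, 'n::finite) chart set \<Rightarrow> ('m, 'n) metric_field set \<Rightarrow>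
     ('m, 'n) density_field \<Rightarrow> real set \<Rightarrow> (real \<Rightarrow> 'm) \<Rightarrow> bool" where
  "generalised_geodesic M A c \<sigma> J \<gamma> \<longleftrightarrow>
     smooth_curve M A J \<gamma> \<and> nowhere_null A c J \<gamma> \<and>
     (\<forall>\<phi>\<in>A. \<forall>g\<in>c. \<forall>t\<in>J. \<gamma> t \<in> dom \<phi> \<longrightarrow> (\<forall>i. wedge_I_Sigma c \<sigma> g \<phi> J \<gamma> t i = 0))"

end

(* Modulo X, the tractors I, U and A have the components (sigma, d sigma), (0, u) and (-s, a) up to
   multiples of u in the last one, with covariant derivatives in a scale g and s = sigma_u. So I lies
   in the span of X, U and A as soon as s^2 (d sigma) + sigma a is proportional to the lowered
   velocity. Off the zero locus this is the geodesic equation of sigma^-2 times the conformal metric,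
   by the conformal change of the Christoffel symbols, in which Jacobi's formula for the derivative of
   det g identifies the weight terms. The condition is closed and makes sense where sigma vanishes,
   so it extends along the curve by density of the parameters off the zero locus. *)
theory Submission
  imports Defs
begin

section \<open>Matrix inverses and Jacobi's formula\<close>

text \<open>The Laplacian of \<sigma> and the Schouten tensor enter the tractors only along X: in
  the middle slot of A the Schouten tensor multiplies the top slot of U, which is 0. As X is itself
  one of the spanning tractors, the last slot never has to be evaluated, and one continuous
  derivative of the metric and of \<sigma> suffices. The obstacle is that the Christoffel symbols of
  the singular metric blow up along the zero locus. They do so only to first order in 1/\<sigma>, so
  one factor \<sigma> turns the geodesic equation into a condition that survives the limit. It is
  imposed on lowered indices because there the inverse metric drops out of the acceleration.\<close>

lemma matrix_inv_mult:
  fixes B :: "real^'n^'n"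
  assumes "det B \<noteq> 0"
  shows "B ** matrix_inv B = mat 1" "matrix_inv B ** B = mat 1"
proof -
  have "\<exists>B'. B ** B' = mat 1 \<and> B' ** B = mat 1"
    using assms by (simp add: invertible_det_nz[symmetric] invertible_def)
  then have "B ** matrix_inv B = mat 1 \<and> matrix_inv B ** B = mat 1"
    unfolding matrix_inv_def by (rule someI_ex)
  then show "B ** matrix_inv B = mat 1" "matrix_inv B ** B = mat 1" by auto
qed

lemma det_scaleR:
  fixes B :: "real^'n^'n"
  shows "det (r *\<^sub>R B) = r ^ CARD('n) * det B"
  by (simp add: det_def sum_distrib_left prod.distrib mult.left_commute)

lemma matrix_inv_scaleR:
  fixes B :: "real^'n^'n"
  assumes "det B \<noteq> 0" "r \<noteq> 0"
  shows "matrix_inv (r *\<^sub>R B) = inverse r *\<^sub>R matrix_inv B"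
proof -
  have d: "det (r *\<^sub>R B) \<noteq> 0" using assms by (simp add: det_scaleR)
  have "(inverse r *\<^sub>R matrix_inv B) ** (r *\<^sub>R B) = mat 1"
    using matrix_inv_mult[OF assms(1)] assms(2)
    by (simp add: matrix_scalar_ac scalar_matrix_assoc)
  then have "(inverse r *\<^sub>R matrix_inv B) ** ((r *\<^sub>R B) ** matrix_inv (r *\<^sub>R B)) = matrix_inv (r *\<^sub>R B)"
    by (simp add: matrix_mul_assoc)
  then show ?thesis
    by (simp add: matrix_inv_mult[OF d])
qed

text \<open>Cramer's rule for the l-th unit vector, whose image under the inverse is the l-th
  column. An entry becomes a quotient of polynomials in the entries of \<open>B\<close>, from which
  its continuity can be read off.\<close>

lemma matrix_inv_cramer:
  fixes B :: "real^'n^'n"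
  assumes "det B \<noteq> 0"
  shows "matrix_inv B $ k $ l = det (\<chi> i j. if j = k then (if i = l then 1 else 0) else B $ i $ j) / det B"
proof -
  have "B *v (matrix_inv B *v axis l 1) = axis l 1"
    by (simp add: matrix_vector_mul_assoc matrix_inv_mult[OF assms])
  then have "matrix_inv B *v axis l 1 =
      (\<chi> k. det (\<chi> i j. if j = k then axis l 1 $ i else B $ i $ j) / det B)"
    by (simp add: cramer[OF assms])
  moreover have "(matrix_inv B *v axis l 1) $ k = matrix_inv B $ k $ l"
    by (simp add: matrix_vector_mult_basis column_def)
  moreover have "axis l (1::real) $ i = (if i = l then 1 else 0)" for i
    by (simp add: axis_def)
  ultimately show ?thesis by (simp only: vec_lambda_beta)
qed

lemma continuous_on_det [continuous_intros]:
  fixes B :: "'a::topological_space \<Rightarrow> real^'n^'n"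
  assumes "\<And>i j. continuous_on S (\<lambda>x. B x $ i $ j)"
  shows "continuous_on S (\<lambda>x. det (B x))"
  unfolding det_def by (intro continuous_intros assms)

lemma continuous_on_matrix_inv_component:
  fixes B :: "'a::topological_space \<Rightarrow> real^'n^'n"
  assumes "\<And>i j. continuous_on S (\<lambda>x. B x $ i $ j)" "\<And>x. x \<in> S \<Longrightarrow> det (B x) \<noteq> 0"
  shows "continuous_on S (\<lambda>x. matrix_inv (B x) $ k $ l)"
proof (rule continuous_on_eq)
  show "continuous_on S (\<lambda>x. det (\<chi> i j. if j = k then (if i = l then 1 else 0) else B x $ i $ j) / det (B x))"
  proof (intro continuous_on_divide continuous_on_det assms)
    fix i j
    show "continuous_on S (\<lambda>x. (\<chi> i j. if j = k then (if i = l then 1 else 0) else B x $ i $ j) $ i $ j)"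
      by (cases "j = k"; cases "i = l") (simp_all add: assms)
  qed (use assms in auto)
qed (use assms in \<open>auto simp: matrix_inv_cramer\<close>)

text \<open>Jacobi's formula at the identity: any other permutation contributes at least two vanishing
  factors, so only the diagonal survives.\<close>

lemma has_derivative_det_mat_1:
  fixes B :: "'a::real_normed_vector \<Rightarrow> real^'n^'n"
  assumes D: "\<And>i j. ((\<lambda>x. B x $ i $ j) has_derivative D i j) (at x within S)"
    and B: "B x = mat 1"
  shows "((\<lambda>x. det (B x)) has_derivative (\<lambda>v. \<Sum>i\<in>UNIV. D i i v)) (at x within S)"
proof -
  let ?P = "{p. p permutes (UNIV :: 'n set)}"
  let ?T = "\<lambda>p v. of_int (sign p) * (\<Sum>i\<in>UNIV. D i (p i) v * (\<Prod>j\<in>UNIV - {i}. B x $ j $ p j))"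
  have *: "((\<lambda>x. det (B x)) has_derivative (\<lambda>v. \<Sum>p\<in>?P. ?T p v)) (at x within S)"
    unfolding det_def
    by (intro has_derivative_sum has_derivative_mult_right has_derivative_prod D)
  have 0: "?T p v = 0" if "p permutes UNIV" "p \<noteq> id" for p v
  proof -
    have "(\<Prod>j\<in>UNIV - {i}. B x $ j $ p j) = 0" for i
    proof -
      have "\<exists>j. j \<noteq> i \<and> p j \<noteq> j"
      proof (rule ccontr)
        assume "\<not> ?thesis"
        then have e: "\<And>j. j \<noteq> i \<Longrightarrow> p j = j" by auto
        then have "p i = i" using permutes_inj[OF that(1)] by (metis injD)
        with e have "p = id" by (metis eq_id_iff)
        with that show False by simp
      qed
      then obtain j where "j \<noteq> i" "p j \<noteq> j" by auto
      then show ?thesis by (intro prod_zero) (auto simp: B mat_def intro!: bexI[of _ j])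
    qed
    then show ?thesis by (simp only: mult_zero_right sum.neutral_const)
  qed
  have "(\<Sum>p\<in>?P. ?T p v) = (\<Sum>i\<in>UNIV. D i i v)" for v
  proof -
    have "(\<Sum>p\<in>?P. ?T p v) = (\<Sum>p\<in>{id}. ?T p v)"
      by (rule sum.mono_neutral_right) (use 0 permutes_id in auto)
    also have "\<dots> = (\<Sum>i\<in>UNIV. D i i v)"
      by (simp add: B mat_def)
    finally show ?thesis .
  qed
  with * show ?thesis by simp
qed

text \<open>Multiplication by the constant matrix \<open>matrix_inv (B x)\<close> moves the base
  point to the identity, where the previous formula applies; multiplicativity of the determinant
  restores the factor \<open>det (B x)\<close>.\<close>

lemma has_derivative_det:
  fixes B :: "'a::real_normed_vector \<Rightarrow> real^'n^'n"
  assumes D: "\<And>i j. ((\<lambda>x. B x $ i $ j) has_derivative D i j) (at x within S)"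
    and B: "det (B x) \<noteq> 0"
  shows "((\<lambda>x. det (B x)) has_derivative
    (\<lambda>v. det (B x) * (\<Sum>k\<in>UNIV. \<Sum>l\<in>UNIV. matrix_inv (B x) $ k $ l * D l k v))) (at x within S)"
proof -
  let ?N = "matrix_inv (B x)"
  have "((\<lambda>y. det (?N ** B y)) has_derivative (\<lambda>v. \<Sum>k\<in>UNIV. \<Sum>l\<in>UNIV. ?N $ k $ l * D l k v)) (at x within S)"
  proof (rule has_derivative_det_mat_1[where D = "\<lambda>i j v. \<Sum>l\<in>UNIV. ?N $ i $ l * D l j v"])
    fix i j
    show "((\<lambda>y. (?N ** B y) $ i $ j) has_derivative (\<lambda>v. \<Sum>l\<in>UNIV. ?N $ i $ l * D l j v)) (at x within S)"
      unfolding matrix_matrix_mult_def vec_lambda_beta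
      by (intro has_derivative_sum has_derivative_mult_right D)
  qed (simp add: matrix_inv_mult[OF B])
  then have "((\<lambda>y. det (B x) * det (?N ** B y)) has_derivative
      (\<lambda>v. det (B x) * (\<Sum>k\<in>UNIV. \<Sum>l\<in>UNIV. ?N $ k $ l * D l k v))) (at x within S)"
    by (rule has_derivative_mult_right)
  moreover have "det (B x) * det (?N ** B y) = det (B y)" for y
    by (simp add: det_mul[symmetric] matrix_mul_assoc matrix_inv_mult[OF B])
  ultimately show ?thesis by simp
qed

section \<open>Calculus in a chart\<close>

definition diff_at :: "('m, 'n::finite) chart \<Rightarrow> 'm \<Rightarrow> ('m \<Rightarrow> real) \<Rightarrow> bool" where
  "diff_at \<phi> p f \<longleftrightarrow> (f \<circ> param \<phi>) differentiable (at (coord \<phi> p) within img \<phi>)"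

definition C1 :: "('m, 'n::finite) chart \<Rightarrow> ('m \<Rightarrow> real) \<Rightarrow> bool" where
  "C1 \<phi> f \<longleftrightarrow> (\<forall>p\<in>dom \<phi>. diff_at \<phi> p f) \<and>
     (\<forall>i. continuous_on (img \<phi>) (pd \<phi> i f \<circ> param \<phi>))"

locale coordinate_chart =
  fixes M :: "'m topology" and \<phi> :: "('m, 'n::finite) chart"
  assumes chart: "chart_on M \<phi>"
begin

lemma inj_coord: "inj_on (coord \<phi>) (dom \<phi>)"
proof -
  have "homeomorphic_map (subtopology M (dom \<phi>)) (top_of_set (img \<phi>)) (coord \<phi>)" "openin M (dom \<phi>)"
    using chart by (auto simp: chart_on_def)
  then show ?thesis
    using homeomorphic_imp_injective_map openin_subset by (metis topspace_subtopology_subset)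
qed

lemma param_coord [simp]: "p \<in> dom \<phi> \<Longrightarrow> param \<phi> (coord \<phi> p) = p"
  by (simp add: param_def inj_coord)

lemma param_in_dom [simp]: "x \<in> img \<phi> \<Longrightarrow> param \<phi> x \<in> dom \<phi>"
  by (simp add: param_def img_def inv_into_into)

lemma coord_param [simp]: "x \<in> img \<phi> \<Longrightarrow> coord \<phi> (param \<phi> x) = x"
  by (simp add: param_def img_def f_inv_into_f)

lemma coord_in_img [simp]: "p \<in> dom \<phi> \<Longrightarrow> coord \<phi> p \<in> img \<phi>"
  by (simp add: img_def)

text \<open>Relatively open subsets of a half-space allow small steps in the positive direction of every
  coordinate axis, also at boundary points.\<close>

lemma frechet_derivative_img:
  fixes f :: "real^'n \<Rightarrow> 'b::real_normed_vector"
  assumes D: "(f has_derivative D) (at x within img \<phi>)" and x: "x \<in> img \<phi>"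
  shows "frechet_derivative f (at x within img \<phi>) = D"
proof -
  obtain U :: "(real^'n) set" and H where U: "open U" "img \<phi> = U \<inter> H"
    and H: "H = UNIV \<or> (\<exists>k. H = {x. 0 \<le> x $ k})"
    using chart unfolding chart_on_def openin_open by (metis inf_commute inf_top_right)
  have step: "\<exists>d. 0 < \<bar>d\<bar> \<and> \<bar>d\<bar> < e \<and> x + d *\<^sub>R i \<in> img \<phi>" if "i \<in> Basis" "0 < e" for i :: "real^'n" and e :: real
  proof -
    obtain r where r: "r > 0" "ball x r \<subseteq> U" using U x openE by blast
    define d where "d = min e r / 2"
    have d: "0 < d" "d < e" "d < r" using r that by (auto simp: d_def)
    have "x + d *\<^sub>R i \<in> ball x r" using d that by (simp add: dist_norm)
    moreover have "i $ k \<ge> 0" for k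
      using that by (auto simp: Basis_vec_def axis_def)
    then have "x + d *\<^sub>R i \<in> H" using H x U d by auto
    ultimately have "x + d *\<^sub>R i \<in> img \<phi>" using r U by auto
    with d show ?thesis by (intro exI[of _ d]) auto
  qed
  have "(f has_derivative frechet_derivative f (at x within img \<phi>)) (at x within img \<phi>)"
    using D differentiable_def frechet_derivative_works by blast
  then show ?thesis
    by (rule frechet_derivative_unique_within[OF _ D step])
qed

lemma pd_eqI:
  assumes "((\<lambda>x. f (param \<phi> x)) has_derivative D) (at (coord \<phi> p) within img \<phi>)" "p \<in> dom \<phi>"
  shows "pd \<phi> i f p = D (axis i 1)"
  using frechet_derivative_img[OF assms(1)] assms(2) by (simp add: pd_def o_def)

lemma diff_atI:
  "((\<lambda>x. f (param \<phi> x)) has_derivative D) (at (coord \<phi> p) within img \<phi>) \<Longrightarrow> diff_at \<phi> p f"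
  by (auto simp: diff_at_def differentiable_def o_def)

text \<open>A linear map is determined by its values on the coordinate axes. With the total
  derivative in this form, product, chain and determinant rules for \<open>pd\<close> follow by
  evaluation at a unit vector.\<close>

lemma diff_at_has_derivative:
  assumes "diff_at \<phi> p f" "p \<in> dom \<phi>"
  shows "((\<lambda>x. f (param \<phi> x)) has_derivative (\<lambda>v. \<Sum>i\<in>UNIV. v $ i * pd \<phi> i f p))
    (at (coord \<phi> p) within img \<phi>)"
proof -
  obtain D where D: "((\<lambda>x. f (param \<phi> x)) has_derivative D) (at (coord \<phi> p) within img \<phi>)"
    using assms(1) by (auto simp: diff_at_def differentiable_def o_def)
  interpret bounded_linear D using D by (rule has_derivative_bounded_linear)
  have "D v = (\<Sum>i\<in>UNIV. v $ i * pd \<phi> i f p)" for v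
  proof -
    have "D v = D (\<Sum>i\<in>UNIV. v $ i *\<^sub>R axis i 1)"
      by (metis basis_expansion scalar_mult_eq_scaleR)
    then show ?thesis by (simp add: sum scaleR pd_eqI[OF D assms(2)])
  qed
  then have "D = (\<lambda>v. \<Sum>i\<in>UNIV. v $ i * pd \<phi> i f p)" by (rule ext)
  with D show ?thesis by simp
qed

lemma diff_at_cong:
  assumes "\<And>q. q \<in> dom \<phi> \<Longrightarrow> f q = f' q" "diff_at \<phi> p f'" "p \<in> dom \<phi>"
  shows "diff_at \<phi> p f" "pd \<phi> i f p = pd \<phi> i f' p"
proof -
  have D: "((\<lambda>x. f (param \<phi> x)) has_derivative (\<lambda>v. \<Sum>i\<in>UNIV. v $ i * pd \<phi> i f' p))
    (at (coord \<phi> p) within img \<phi>)"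
    by (rule has_derivative_transform[OF _ _ diff_at_has_derivative[OF assms(2,3)]])
      (use assms in auto)
  show "diff_at \<phi> p f" "pd \<phi> i f p = pd \<phi> i f' p"
    using diff_atI[OF D] pd_eqI[OF D assms(3)] by (auto simp: axis_def if_distrib if_distribR cong: if_cong)
qed

lemma diff_at_mult:
  assumes "diff_at \<phi> p f" "diff_at \<phi> p f'" "p \<in> dom \<phi>"
  shows "diff_at \<phi> p (\<lambda>q. f q * f' q)"
    "pd \<phi> i (\<lambda>q. f q * f' q) p = f p * pd \<phi> i f' p + pd \<phi> i f p * f' p"
  using has_derivative_mult[OF diff_at_has_derivative[OF assms(1,3)] diff_at_has_derivative[OF assms(2,3)]]
  by (auto dest: diff_atI simp: pd_eqI assms axis_def if_distrib if_distribR cong: if_cong)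

lemma diff_at_comp:
  assumes "diff_at \<phi> p f" "p \<in> dom \<phi>" "(F has_real_derivative F') (at (f p))"
  shows "diff_at \<phi> p (\<lambda>q. F (f q))" "pd \<phi> i (\<lambda>q. F (f q)) p = F' * pd \<phi> i f p"
proof -
  have "((\<lambda>x. F (f (param \<phi> x))) has_derivative (\<lambda>v. (\<Sum>i\<in>UNIV. v $ i * pd \<phi> i f p) * F'))
     (at (coord \<phi> p) within img \<phi>)"
    by (rule DERIV_compose_FDERIV[OF _ diff_at_has_derivative[OF assms(1,2)]]) (use assms in auto)
  then show "diff_at \<phi> p (\<lambda>q. F (f q))" "pd \<phi> i (\<lambda>q. F (f q)) p = F' * pd \<phi> i f p"
    by (auto dest: diff_atI simp: pd_eqI assms axis_def if_distrib if_distribR cong: if_cong)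
qed

lemma diff_at_det:
  fixes B :: "'m \<Rightarrow> real^'k^'k"
  assumes "\<And>k l. diff_at \<phi> p (\<lambda>q. B q $ k $ l)" "p \<in> dom \<phi>" "det (B p) \<noteq> 0"
  shows "diff_at \<phi> p (\<lambda>q. det (B q))"
    "pd \<phi> i (\<lambda>q. det (B q)) p =
      det (B p) * (\<Sum>k\<in>UNIV. \<Sum>l\<in>UNIV. matrix_inv (B p) $ k $ l * pd \<phi> i (\<lambda>q. B q $ l $ k) p)"
proof -
  have D: "((\<lambda>x. det (B (param \<phi> x))) has_derivative
    (\<lambda>v. det (B p) * (\<Sum>k\<in>UNIV. \<Sum>l\<in>UNIV. matrix_inv (B p) $ k $ l *
       (\<Sum>i\<in>UNIV. v $ i * pd \<phi> i (\<lambda>q. B q $ l $ k) p)))) (at (coord \<phi> p) within img \<phi>)"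
    using has_derivative_det[of "\<lambda>x. B (param \<phi> x)", OF diff_at_has_derivative[OF assms(1,2)]] assms(2,3)
    by simp
  show "diff_at \<phi> p (\<lambda>q. det (B q))"
    "pd \<phi> i (\<lambda>q. det (B q)) p =
      det (B p) * (\<Sum>k\<in>UNIV. \<Sum>l\<in>UNIV. matrix_inv (B p) $ k $ l * pd \<phi> i (\<lambda>q. B q $ l $ k) p)"
    using diff_atI[OF D] pd_eqI[OF D assms(2)] by (auto simp: axis_def if_distrib if_distribR cong: if_cong)
qed

lemma C1_imp_continuous_on:
  assumes "C1 \<phi> f"
  shows "continuous_on (img \<phi>) (\<lambda>x. f (param \<phi> x))"
  unfolding continuous_on_eq_continuous_within
proof
  fix x assume "x \<in> img \<phi>"
  then have "diff_at \<phi> (param \<phi> x) f" "param \<phi> x \<in> dom \<phi>"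
    using assms by (auto simp: C1_def)
  from has_derivative_continuous[OF diff_at_has_derivative[OF this]] \<open>x \<in> img \<phi>\<close>
  show "continuous (at x within img \<phi>) (\<lambda>x. f (param \<phi> x))" by simp
qed

lemma C1_mult:
  assumes "C1 \<phi> f" "C1 \<phi> f'"
  shows "C1 \<phi> (\<lambda>q. f q * f' q)"
proof -
  have "continuous_on (img \<phi>) (pd \<phi> i (\<lambda>q. f q * f' q) \<circ> param \<phi>)" for i
  proof (rule continuous_on_eq)
    show "continuous_on (img \<phi>) (\<lambda>x. f (param \<phi> x) * (pd \<phi> i f' \<circ> param \<phi>) x
        + (pd \<phi> i f \<circ> param \<phi>) x * f' (param \<phi> x))"
      using assms by (intro continuous_intros C1_imp_continuous_on) (auto simp: C1_def)
  qed (use assms in \<open>auto simp: C1_def diff_at_mult\<close>)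
  with assms show ?thesis by (auto simp: C1_def diff_at_mult)
qed

lemma C1_exp:
  assumes "C1 \<phi> f"
  shows "C1 \<phi> (\<lambda>q. exp (r * f q))"
proof -
  have D: "((\<lambda>x. exp (r * x)) has_real_derivative (r * exp (r * x))) (at x)" for x
    by (auto intro!: derivative_eq_intros)
  have "continuous_on (img \<phi>) (pd \<phi> i (\<lambda>q. exp (r * f q)) \<circ> param \<phi>)" for i
  proof (rule continuous_on_eq)
    show "continuous_on (img \<phi>) (\<lambda>x. r * exp (r * f (param \<phi> x)) * (pd \<phi> i f \<circ> param \<phi>) x)"
      using assms by (intro continuous_intros C1_imp_continuous_on) (auto simp: C1_def)
  qed (use assms in \<open>auto simp: C1_def diff_at_comp(2)[OF _ _ D]\<close>)
  with assms show ?thesis by (auto simp: C1_def diff_at_comp(1)[OF _ _ D])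
qed

lemma C1_cong:
  assumes "\<And>q. q \<in> dom \<phi> \<Longrightarrow> f q = f' q" "C1 \<phi> f'"
  shows "C1 \<phi> f"
proof -
  have "continuous_on (img \<phi>) (pd \<phi> i f \<circ> param \<phi>)" for i
    by (rule continuous_on_eq[of _ "pd \<phi> i f' \<circ> param \<phi>"])
      (use assms in \<open>auto simp: C1_def diff_at_cong(2)[OF assms(1)]\<close>)
  with assms show ?thesis by (auto simp: C1_def diff_at_cong(1)[OF assms(1)])
qed

text \<open>A bounded linear functional commutes with differentiation. Taking \<open>L\<close> to be
  the selection of an entry passes from a smooth matrix-valued field to its scalar
  components.\<close>

lemma smooth_on_imp_C1:
  fixes F :: "'m \<Rightarrow> 'b::real_normed_vector" and L :: "'b \<Rightarrow> real"
  assumes "smooth_on (img \<phi>) (F \<circ> param \<phi>)" "bounded_linear L"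
  shows "C1 \<phi> (\<lambda>q. L (F q))"
proof -
  let ?D = "\<lambda>x. frechet_derivative (F \<circ> param \<phi>) (at x within img \<phi>)"
  have C: "Ck_on (Suc 0) (img \<phi>) (F \<circ> param \<phi>)" using assms(1) by (simp add: smooth_on_def)
  have D: "((\<lambda>x. L (F (param \<phi> x))) has_derivative (\<lambda>v. L (?D x v))) (at x within img \<phi>)"
    if "x \<in> img \<phi>" for x
  proof (rule bounded_linear.has_derivative[OF assms(2)])
    show "((\<lambda>x. F (param \<phi> x)) has_derivative ?D x) (at x within img \<phi>)"
      using C that unfolding o_def by (simp add: differentiable_on_def frechet_derivative_works)
  qed
  have "diff_at \<phi> p (\<lambda>q. L (F q))" if "p \<in> dom \<phi>" for p
    using diff_atI[OF D[of "coord \<phi> p"]] that by simp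
  moreover have "continuous_on (img \<phi>) (pd \<phi> i (\<lambda>q. L (F q)) \<circ> param \<phi>)" for i
  proof (rule continuous_on_eq)
    have "axis i (1::real) \<in> Basis" by (simp add: axis_in_Basis_iff)
    with C show "continuous_on (img \<phi>) (\<lambda>x. L (?D x (axis i 1)))"
      by (intro bounded_linear.continuous_on[OF assms(2)]) auto
    show "L (?D x (axis i 1)) = (pd \<phi> i (\<lambda>q. L (F q)) \<circ> param \<phi>) x" if "x \<in> img \<phi>" for x
      using pd_eqI[of "\<lambda>q. L (F q)" _ "param \<phi> x"] D[OF that] that by simp
  qed
  ultimately show ?thesis by (simp add: C1_def)
qed

end

section \<open>Conformal change of the Levi-Civita connection\<close>

text \<open>Near a nonzero point the modulus is x or -x, and the sign is absorbed by the division by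
  x. Both signs occur because \<open>chart_metric\<close> fixes only that the determinant is
  nonzero.\<close>

lemma powr_abs_has_real_derivative:
  fixes x :: real
  assumes "x \<noteq> 0"
  shows "((\<lambda>x. \<bar>x\<bar> powr a) has_real_derivative a * \<bar>x\<bar> powr a / x) (at x)"
proof (cases "x > 0")
  case True
  have "((\<lambda>x. x powr a) has_real_derivative a * \<bar>x\<bar> powr a / x) (at x)"
    using True by (auto intro!: derivative_eq_intros simp: powr_diff)
  moreover have "\<forall>\<^sub>F y in nhds x. \<bar>y\<bar> powr a = y powr a"
    using eventually_nhds_in_open[of "{0<..}" x] True by (auto elim: eventually_mono)
  ultimately show ?thesis by (subst DERIV_cong_ev) auto
next
  case False
  have "((\<lambda>x. (- x) powr a) has_real_derivative a * \<bar>x\<bar> powr a / x) (at x)"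
    using False assms by (auto intro!: derivative_eq_intros simp: powr_diff)
  moreover have "\<forall>\<^sub>F y in nhds x. \<bar>y\<bar> powr a = (- y) powr a"
    using eventually_nhds_in_open[of "{..<0}" x] False assms by (auto elim: eventually_mono)
  ultimately show ?thesis by (subst DERIV_cong_ev) auto
qed

locale chart_metric = coordinate_chart M \<phi>
  for M :: "'m topology" and \<phi> :: "('m, 'n::finite) chart" +
  fixes g :: "('m, 'n) metric_field"
  assumes C1_metric: "\<And>i j. C1 \<phi> (\<lambda>q. g \<phi> q $ i $ j)"
    and metric_sym: "\<And>p i j. p \<in> dom \<phi> \<Longrightarrow> g \<phi> p $ i $ j = g \<phi> p $ j $ i"
    and metric_det: "\<And>p. p \<in> dom \<phi> \<Longrightarrow> det (g \<phi> p) \<noteq> 0"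
begin

lemma diff_metric: "p \<in> dom \<phi> \<Longrightarrow> diff_at \<phi> p (\<lambda>q. g \<phi> q $ i $ j)"
  using C1_metric by (auto simp: C1_def)

lemma pd_metric_sym:
  assumes "p \<in> dom \<phi>"
  shows "pd \<phi> l (\<lambda>q. g \<phi> q $ i $ j) p = pd \<phi> l (\<lambda>q. g \<phi> q $ j $ i) p"
  by (rule diff_at_cong(2)[OF metric_sym diff_metric]) (use assms in auto)

lemma metric_mult_inv:
  assumes "p \<in> dom \<phi>"
  shows "(\<Sum>k\<in>UNIV. g \<phi> p $ i $ k * matrix_inv (g \<phi> p) $ k $ j) = (if i = j then 1 else 0)"
  using matrix_inv_mult(1)[OF metric_det[OF assms]]
  by (simp add: vec_eq_iff matrix_matrix_mult_def mat_def)

lemma inv_mult_metric: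
  assumes "p \<in> dom \<phi>"
  shows "(\<Sum>k\<in>UNIV. matrix_inv (g \<phi> p) $ i $ k * g \<phi> p $ k $ j) = (if i = j then 1 else 0)"
  using matrix_inv_mult(2)[OF metric_det[OF assms]]
  by (simp add: vec_eq_iff matrix_matrix_mult_def mat_def)

lemma inv_sym:
  assumes "p \<in> dom \<phi>"
  shows "matrix_inv (g \<phi> p) $ i $ j = matrix_inv (g \<phi> p) $ j $ i"
proof -
  let ?B = "g \<phi> p" and ?N = "matrix_inv (g \<phi> p)"
  have "transpose ?B = ?B" using metric_sym[OF assms] by (simp add: transpose_def vec_eq_iff)
  then have "transpose ?N ** ?B = transpose (?B ** ?N)"
    by (simp only: matrix_transpose_mul)
  then have 1: "transpose ?N ** ?B = mat 1"
    by (simp add: matrix_inv_mult[OF metric_det[OF assms]] transpose_mat)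
  have "transpose ?N = transpose ?N ** (?B ** ?N)"
    by (simp add: matrix_inv_mult[OF metric_det[OF assms]])
  also have "\<dots> = ?N"
    unfolding matrix_mul_assoc 1 by simp
  finally have "transpose ?N $ i $ j = ?N $ i $ j" by simp
  then show ?thesis by (simp add: transpose_def)
qed

lemma lower_raise:
  assumes "p \<in> dom \<phi>"
  shows "(\<Sum>k\<in>UNIV. g \<phi> p $ l $ k * (\<Sum>m\<in>UNIV. matrix_inv (g \<phi> p) $ k $ m * B m)) = B l"
proof -
  have "(\<Sum>k\<in>UNIV. g \<phi> p $ l $ k * (\<Sum>m\<in>UNIV. matrix_inv (g \<phi> p) $ k $ m * B m)) =
    (\<Sum>m\<in>UNIV. (\<Sum>k\<in>UNIV. g \<phi> p $ l $ k * matrix_inv (g \<phi> p) $ k $ m) * B m)"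
    by (simp add: sum_distrib_left sum_distrib_right mult.assoc, subst sum.swap, rule refl)
  then show ?thesis by (simp add: metric_mult_inv[OF assms] if_distrib if_distribR cong: if_cong)
qed

text \<open>Lowering the upper index cancels the inverse metric and leaves the Christoffel symbols
  of the first kind.\<close>

lemma christoffel_lower:
  assumes "p \<in> dom \<phi>"
  shows "(\<Sum>k\<in>UNIV. g \<phi> p $ l $ k * christoffel g \<phi> k i j p) =
    (pd \<phi> i (\<lambda>q. g \<phi> q $ j $ l) p + pd \<phi> j (\<lambda>q. g \<phi> q $ i $ l) p - pd \<phi> l (\<lambda>q. g \<phi> q $ i $ j) p) / 2"
proof -
  let ?B = "\<lambda>l. pd \<phi> i (\<lambda>q. g \<phi> q $ j $ l) p + pd \<phi> j (\<lambda>q. g \<phi> q $ i $ l) p - pd \<phi> l (\<lambda>q. g \<phi> q $ i $ j) p"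
  have "(\<Sum>k\<in>UNIV. g \<phi> p $ l $ k * christoffel g \<phi> k i j p) =
      1/2 * (\<Sum>k\<in>UNIV. g \<phi> p $ l $ k * (\<Sum>m\<in>UNIV. matrix_inv (g \<phi> p) $ k $ m * ?B m))"
    unfolding christoffel_def sum_distrib_left
    by (simp only: mult.left_commute[of "g \<phi> p $ l $ _" "1/2"])
  then show ?thesis unfolding lower_raise[OF assms] by simp
qed

text \<open>Of the three derivative terms, two are exchanged by renaming the summation indices,
  since the inverse is symmetric, and cancel. The rest is the logarithmic derivative of the square
  root of the modulus of \<open>det g\<close>, the form in which Jacobi's formula applies.\<close>

lemma christoffel_trace_eq:
  assumes "p \<in> dom \<phi>"
  shows "christoffel_trace g \<phi> i p =
    (\<Sum>k\<in>UNIV. \<Sum>l\<in>UNIV. matrix_inv (g \<phi> p) $ k $ l * pd \<phi> i (\<lambda>q. g \<phi> q $ l $ k) p) / 2"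
proof -
  let ?N = "\<lambda>k l. matrix_inv (g \<phi> p) $ k $ l"
  have "(\<Sum>k\<in>UNIV. \<Sum>l\<in>UNIV. ?N k l * pd \<phi> k (\<lambda>q. g \<phi> q $ i $ l) p) =
      (\<Sum>k\<in>UNIV. \<Sum>l\<in>UNIV. ?N k l * pd \<phi> l (\<lambda>q. g \<phi> q $ i $ k) p)"
    by (subst sum.swap, rule sum.cong[OF refl], rule sum.cong[OF refl]) (simp add: inv_sym[OF assms])
  moreover have "christoffel_trace g \<phi> i p =
      ((\<Sum>k\<in>UNIV. \<Sum>l\<in>UNIV. ?N k l * pd \<phi> i (\<lambda>q. g \<phi> q $ k $ l) p)
        + (\<Sum>k\<in>UNIV. \<Sum>l\<in>UNIV. ?N k l * pd \<phi> k (\<lambda>q. g \<phi> q $ i $ l) p)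
        - (\<Sum>k\<in>UNIV. \<Sum>l\<in>UNIV. ?N k l * pd \<phi> l (\<lambda>q. g \<phi> q $ i $ k) p)) / 2"
    unfolding christoffel_trace_def christoffel_def sum_distrib_left[of "1/2", symmetric]
    by (simp add: distrib_left right_diff_distrib sum.distrib sum_subtractf)
  moreover have "pd \<phi> i (\<lambda>q. g \<phi> q $ k $ l) p = pd \<phi> i (\<lambda>q. g \<phi> q $ l $ k) p" for k l
    by (rule pd_metric_sym[OF assms])
  ultimately show ?thesis by simp
qed

text \<open>The second conclusion says that the scale of \<open>g\<close> is parallel: its
  \<open>nabla_density\<close> of weight 1 vanishes. The exponent -1/(2n) turns the trace in
  Jacobi's formula into the Christoffel trace divided by n.\<close>

lemma diff_scale_density:
  assumes "p \<in> dom \<phi>"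
  shows "diff_at \<phi> p (scale_density g \<phi>)"
    "pd \<phi> i (scale_density g \<phi>) p = - christoffel_trace g \<phi> i p / real CARD('n) * scale_density g \<phi> p"
proof -
  define a where "a = - 1 / (2 * real CARD('n))"
  have s: "scale_density g \<phi> = (\<lambda>q. \<bar>det (g \<phi> q)\<bar> powr a)"
    by (simp add: scale_density_def a_def fun_eq_iff)
  note D = diff_at_det[OF diff_metric[OF assms] assms metric_det[OF assms]]
  note E = diff_at_comp[OF D(1) assms powr_abs_has_real_derivative[OF metric_det[OF assms], of a]]
  show "diff_at \<phi> p (scale_density g \<phi>)" unfolding s by (rule E(1))
  show "pd \<phi> i (scale_density g \<phi>) p = - christoffel_trace g \<phi> i p / real CARD('n) * scale_density g \<phi> p"
    unfolding s E(2) D(2) christoffel_trace_eq[OF assms]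
    using metric_det[OF assms] by (simp add: a_def field_simps)
qed

lemma scale_density_pos: "p \<in> dom \<phi> \<Longrightarrow> scale_density g \<phi> p > 0"
  using metric_det by (simp add: scale_density_def)

text \<open>The product rule splits the derivative of \<open>h\<close> into f dg, which reproduces
  the symbols of \<open>g\<close> because the inverse carries 1/f, and df times g, whose
  contractions with the inverse metric are Kronecker deltas and a raised gradient. The one-form of
  the change is df/(2f).\<close>

lemma christoffel_conformal:
  assumes p: "p \<in> dom \<phi>" and h: "\<And>q. q \<in> dom \<phi> \<Longrightarrow> h \<phi> q = f q *\<^sub>R g \<phi> q"
    and f: "diff_at \<phi> p f" "f p \<noteq> 0"
  shows "christoffel h \<phi> k i j p = christoffel g \<phi> k i j p +
    ((if k = j then pd \<phi> i f p else 0) + (if k = i then pd \<phi> j f p else 0)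
      - g \<phi> p $ i $ j * (\<Sum>l\<in>UNIV. matrix_inv (g \<phi> p) $ k $ l * pd \<phi> l f p)) / (2 * f p)"
proof -
  let ?N = "\<lambda>k l. matrix_inv (g \<phi> p) $ k $ l"
  let ?dg = "\<lambda>l i j. pd \<phi> l (\<lambda>q. g \<phi> q $ i $ j) p" and ?df = "\<lambda>i. pd \<phi> i f p"
  have pd_h: "pd \<phi> l (\<lambda>q. h \<phi> q $ i $ j) p = f p * ?dg l i j + ?df l * g \<phi> p $ i $ j" for l i j
    using diff_at_cong(2)[OF _ diff_at_mult(1)[OF f(1) diff_metric[OF p] p] p, of "\<lambda>q. h \<phi> q $ i $ j" i j l]
    by (simp add: h diff_at_mult(2)[OF f(1) diff_metric[OF p] p])
  have N: "(\<Sum>l\<in>UNIV. ?N k l * (c * g \<phi> p $ j $ l)) = (if k = j then c else 0)" for j c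
    using inv_mult_metric[OF p, of k j]
    by (simp add: mult.left_commute[of _ c] sum_distrib_left[symmetric] metric_sym[OF p, of j])
  have sum_split: "(\<Sum>l\<in>UNIV. n l * (F * x l + (y l + z l - d l * u))) =
      F * (\<Sum>l\<in>UNIV. n l * x l) + ((\<Sum>l\<in>UNIV. n l * y l) + (\<Sum>l\<in>UNIV. n l * z l) - u * (\<Sum>l\<in>UNIV. n l * d l))"
    for n x y z d :: "'n \<Rightarrow> real" and F u
    by (simp add: distrib_left right_diff_distrib sum.distrib sum_subtractf sum_distrib_left ac_simps)
  have "christoffel h \<phi> k i j p = (\<Sum>l\<in>UNIV. ?N k l * (f p * (?dg i j l + ?dg j i l - ?dg l i j)
      + (?df i * g \<phi> p $ j $ l + ?df j * g \<phi> p $ i $ l - ?df l * g \<phi> p $ i $ j))) / (2 * f p)"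
    unfolding christoffel_def pd_h h[OF p] matrix_inv_scaleR[OF metric_det[OF p] f(2)]
    unfolding sum_distrib_left sum_divide_distrib
    by (rule sum.cong) (simp_all add: divide_simps f(2), simp add: algebra_simps)
  also have "(\<Sum>l\<in>UNIV. ?N k l * (f p * (?dg i j l + ?dg j i l - ?dg l i j)
      + (?df i * g \<phi> p $ j $ l + ?df j * g \<phi> p $ i $ l - ?df l * g \<phi> p $ i $ j))) =
      f p * (\<Sum>l\<in>UNIV. ?N k l * (?dg i j l + ?dg j i l - ?dg l i j)) +
      ((if k = j then ?df i else 0) + (if k = i then ?df j else 0)
        - g \<phi> p $ i $ j * (\<Sum>l\<in>UNIV. ?N k l * ?df l))"
    by (simp only: sum_split N)
  finally show ?thesis
    unfolding christoffel_def using f(2) by (simp add: add_divide_distrib diff_divide_distrib)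
qed

text \<open>The one-form of the conformal change from \<open>g\<close> to \<open>\<sigma>\<^sup>-\<^sup>2 \<sigma>\<^sub>g\<^sup>2 g\<close> is \<open>- \<nabla>\<sigma> / \<sigma>\<close>.\<close>

lemma christoffel_singular:
  assumes p: "p \<in> dom \<phi>" and h: "\<And>q. q \<in> dom \<phi> \<Longrightarrow> h \<phi> q = (inverse ((s q)\<^sup>2) * (scale_density g \<phi> q)\<^sup>2) *\<^sub>R g \<phi> q"
    and s: "diff_at \<phi> p s" "s p \<noteq> 0"
  defines "N \<equiv> \<lambda>i. nabla_density 1 g \<phi> s i p"
  shows "christoffel h \<phi> k i j p = christoffel g \<phi> k i j p -
    ((if k = j then N i else 0) + (if k = i then N j else 0)
      - g \<phi> p $ i $ j * (\<Sum>l\<in>UNIV. matrix_inv (g \<phi> p) $ k $ l * N l)) / s p"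
proof -
  let ?f = "\<lambda>q. inverse ((s q)\<^sup>2) * (scale_density g \<phi> q)\<^sup>2"
  have "((\<lambda>x. inverse (x\<^sup>2)) has_real_derivative - 2 / x ^ 3) (at x)" if "x \<noteq> 0" for x :: real
    using that by (auto intro!: derivative_eq_intros simp: power2_eq_square power3_eq_cube field_simps)
  note a = diff_at_comp[OF s(1) p this[OF s(2)]]
  have "((\<lambda>x. x\<^sup>2) has_real_derivative 2 * x) (at x)" for x :: real
    by (auto intro!: derivative_eq_intros)
  note b = diff_at_comp[OF diff_scale_density(1)[OF p] p this]
  have f: "diff_at \<phi> p ?f" "?f p \<noteq> 0"
    using diff_at_mult(1)[OF a(1) b(1) p] s(2) scale_density_pos[OF p] by auto
  \<comment> \<open>The inverse square of \<open>s\<close> contributes -2 ds/s to the logarithmic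
    derivative, and the square of the parallel scale contributes -2/n times the Christoffel trace:
    exactly the weight term that completes ds to the covariant derivative.\<close>
  have "pd \<phi> i ?f p = - 2 * ?f p / s p * N i" for i
    unfolding diff_at_mult(2)[OF a(1) b(1) p] a(2) b(2) diff_scale_density(2)[OF p] N_def nabla_density_def
    using s(2) by (simp add: field_simps power2_eq_square power3_eq_cube)
  then have pd: "pd \<phi> i ?f p = (- 2 * ?f p / s p) * N i" for i .
  have "(\<Sum>l\<in>UNIV. matrix_inv (g \<phi> p) $ k $ l * ((- 2 * ?f p / s p) * N l)) =
      (- 2 * ?f p / s p) * (\<Sum>l\<in>UNIV. matrix_inv (g \<phi> p) $ k $ l * N l)"
    unfolding sum_distrib_left by (rule sum.cong) (simp_all only: ac_simps)
  note eq = christoffel_conformal[of p h ?f k i j, OF p h f, unfolded pd this]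
  have "((if P then c * a else 0) + (if Q then c * b else 0) - u * (c * S)) / (2 * F) =
      - (((if P then a else 0) + (if Q then b else 0) - u * S) / t)"
    if "c = - 2 * F / t" "F \<noteq> 0" "t \<noteq> 0" for P Q and a b c u S F t :: real
    unfolding that(1) using that(2,3) by (cases P; cases Q) (simp_all add: divide_simps, simp_all add: algebra_simps)
  note this[OF refl f(2) s(2)]
  with eq show ?thesis by simp
qed

end

section \<open>Calculus along a curve\<close>

locale chart_curve = chart_metric M \<phi> g
  for M :: "'m topology" and \<phi> :: "('m, 'n::finite) chart" and g :: "('m, 'n) metric_field" +
  fixes J :: "real set" and \<gamma> :: "real \<Rightarrow> 'm"
  assumes J: "is_interval J" "interior J \<noteq> {}"
    and cont: "continuous_map (top_of_set J) M \<gamma>"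
    and smooth: "smooth_on {t \<in> J. \<gamma> t \<in> dom \<phi>} (coord \<phi> \<circ> \<gamma>)"
    and regular: "\<And>t. t \<in> J \<Longrightarrow> \<gamma> t \<in> dom \<phi> \<Longrightarrow> velocity \<phi> J \<gamma> t \<noteq> 0"
    and posdef: "\<And>p v. p \<in> dom \<phi> \<Longrightarrow> v \<noteq> 0 \<Longrightarrow> v \<bullet> (g \<phi> p *v v) > 0"
begin

definition T :: "real set" where "T = {t \<in> J. \<gamma> t \<in> dom \<phi>}"

abbreviation u :: "real \<Rightarrow> real^'n" where "u \<equiv> velocity \<phi> J \<gamma>"

definition u_dot :: "real \<Rightarrow> real^'n" where "u_dot t = vector_derivative u (at t within J)"

definition u_flat :: "real \<Rightarrow> real^'n" where "u_flat t = g \<phi> (\<gamma> t) *v u t"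

definition sq :: "real \<Rightarrow> real" where "sq t = u t \<bullet> u_flat t"

lemma T_D: "t \<in> T \<Longrightarrow> t \<in> J" "t \<in> T \<Longrightarrow> \<gamma> t \<in> dom \<phi>"
  by (auto simp: T_def)

lemma sq_pos: "t \<in> T \<Longrightarrow> sq t > 0"
  using posdef regular by (auto simp: sq_def u_flat_def T_def)

lemma T_relatively_open: "\<exists>U. open U \<and> T = J \<inter> U"
proof -
  have "openin (top_of_set J) {t \<in> topspace (top_of_set J). \<gamma> t \<in> dom \<phi>}"
    using chart by (intro openin_continuous_map_preimage[OF cont]) (auto simp: chart_on_def)
  then show ?thesis by (auto simp: T_def openin_open)
qed

lemma at_within_T: "t \<in> T \<Longrightarrow> at t within T = at t within J"
  by (smt (verit) T_relatively_open Int_iff at_within_nhd inf_assoc inf.idem inf_commute)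

text \<open>A connected set with more than one point has no isolated points. Vector derivatives
  within \<open>J\<close> are therefore unique, also at end points of \<open>J\<close>.\<close>

lemma at_within_J_nontrivial: "t \<in> T \<Longrightarrow> at t within J \<noteq> bot"
proof -
  assume "t \<in> T"
  moreover have "J \<noteq> {x}" for x using J(2) by auto
  ultimately show ?thesis
    using connected_imp_perfect[of J t] J(1) T_D by (auto simp: is_interval_connected trivial_limit_within)
qed

text \<open>Component formulas hold only while the curve stays in the chart. They may still be
  differentiated within \<open>J\<close>, because \<open>T\<close> is relatively open in
  \<open>J\<close>.\<close>

lemma has_vector_derivative_cong_T:
  assumes "t \<in> T" "(f has_vector_derivative D) (at t within J)" "\<And>r. r \<in> T \<Longrightarrow> f r = f' r"
  shows "(f' has_vector_derivative D) (at t within J)"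
proof -
  have "(f has_vector_derivative D) (at t within T)" using assms at_within_T by simp
  then have "(f' has_vector_derivative D) (at t within T)"
    by (rule has_vector_derivative_transform[rotated 2]) (use assms in auto)
  then show ?thesis using assms at_within_T by simp
qed

text \<open>\<open>velocity\<close> uses vector derivatives within \<open>J\<close>,
  \<open>smooth_on\<close> uses Frechet derivatives within \<open>T\<close>. The two filters agree
  at points of \<open>T\<close>, and a linear map on the reals is determined by its value at 1. Two
  steps of \<open>Ck_on\<close> reach the continuous second derivative.\<close>

lemma curve_derivatives:
  assumes "t \<in> T"
  shows "((\<lambda>r. coord \<phi> (\<gamma> r)) has_vector_derivative u t) (at t within J)"
    and "(u has_vector_derivative u_dot t) (at t within J)"
    and "continuous_on T u_dot"
proof -
  let ?x = "\<lambda>r. coord \<phi> (\<gamma> r)"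
  have C: "Ck_on (Suc (Suc 0)) T ?x" using smooth unfolding smooth_on_def T_def o_def by blast
  have works: "(f has_vector_derivative frechet_derivative f (at r within T) 1) (at r within J)"
    if "f differentiable (at r within T)" "r \<in> T" for f :: "real \<Rightarrow> real^'n" and r
  proof -
    have D: "(f has_derivative frechet_derivative f (at r within T)) (at r within T)"
      using that frechet_derivative_works by blast
    then interpret bounded_linear "frechet_derivative f (at r within T)"
      by (rule has_derivative_bounded_linear)
    have "frechet_derivative f (at r within T) = (\<lambda>x. x *\<^sub>R frechet_derivative f (at r within T) 1)"
      by (simp add: scaleR[symmetric] fun_eq_iff)
    with D show ?thesis
      unfolding has_vector_derivative_def using at_within_T that by metis
  qed
  have x: "(?x has_vector_derivative frechet_derivative ?x (at r within T) 1) (at r within J)" if "r \<in> T" for r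
    using works[of ?x r] C that by (auto simp: differentiable_on_def)
  have u: "u r = frechet_derivative ?x (at r within T) 1" if "r \<in> T" for r
    unfolding velocity_def o_def
    by (rule vector_derivative_within[OF at_within_J_nontrivial x]) (use that in auto)
  show "(?x has_vector_derivative u t) (at t within J)" using x u assms by simp
  let ?u = "\<lambda>r. frechet_derivative ?x (at r within T) 1"
  have C1: "Ck_on (Suc 0) T ?u" using C by simp
  have d: "(u has_vector_derivative frechet_derivative ?u (at r within T) 1) (at r within J)" if "r \<in> T" for r
    by (rule has_vector_derivative_cong_T[OF that works]) (use C1 that u in \<open>auto simp: differentiable_on_def\<close>)
  have ud: "u_dot r = frechet_derivative ?u (at r within T) 1" if "r \<in> T" for r
    unfolding u_dot_def by (rule vector_derivative_within[OF at_within_J_nontrivial d]) (use that in auto)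
  show "(u has_vector_derivative u_dot t) (at t within J)" using d ud assms by simp
  show "continuous_on T u_dot"
    by (rule continuous_on_eq[of _ "\<lambda>r. frechet_derivative ?u (at r within T) 1"]) (use C1 ud in auto)
qed

lemma derivative_along_curve:
  assumes "t \<in> T" "diff_at \<phi> (\<gamma> t) f"
  shows "((\<lambda>r. f (\<gamma> r)) has_vector_derivative (\<Sum>i\<in>UNIV. u t $ i * pd \<phi> i f (\<gamma> t))) (at t within J)"
proof -
  let ?x = "\<lambda>r. coord \<phi> (\<gamma> r)"
  have x: "(?x has_derivative (\<lambda>h. h *\<^sub>R u t)) (at t within T)"
    using curve_derivatives(1)[OF assms(1)] at_within_T assms by (simp add: has_vector_derivative_def)
  have "((\<lambda>x. f (param \<phi> x)) has_derivative (\<lambda>v. \<Sum>i\<in>UNIV. v $ i * pd \<phi> i f (\<gamma> t))) (at (?x t) within ?x ` T)"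
    by (rule has_derivative_subset[OF diff_at_has_derivative]) (use assms T_D in auto)
  from diff_chain_within[OF x this]
  have "((\<lambda>r. f (param \<phi> (?x r))) has_vector_derivative (\<Sum>i\<in>UNIV. u t $ i * pd \<phi> i f (\<gamma> t))) (at t within J)"
    unfolding has_vector_derivative_def o_def using at_within_T[OF assms(1)]
    by (simp add: sum_distrib_left mult.assoc)
  then show ?thesis
    by (rule has_vector_derivative_cong_T[OF assms(1)]) (use T_D in auto)
qed

lemma continuous_on_u: "continuous_on T u"
  and continuous_on_coord_curve: "continuous_on T (\<lambda>r. coord \<phi> (\<gamma> r))"
  unfolding continuous_on_eq_continuous_within
  using curve_derivatives(1,2) has_vector_derivative_continuous at_within_T by metis+

lemma continuous_on_curve:
  assumes "continuous_on (img \<phi>) (f \<circ> param \<phi>)"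
  shows "continuous_on T (\<lambda>t. f (\<gamma> t))"
proof (rule continuous_on_eq)
  show "continuous_on T (\<lambda>t. (f \<circ> param \<phi>) (coord \<phi> (\<gamma> t)))"
    by (rule continuous_on_compose2[OF assms continuous_on_coord_curve]) (use T_D in auto)
qed (use T_D in auto)

lemma continuous_on_C1_curve:
  assumes "C1 \<phi> f"
  shows "continuous_on T (\<lambda>t. f (\<gamma> t))" "continuous_on T (\<lambda>t. pd \<phi> i f (\<gamma> t))"
  using assms C1_imp_continuous_on[OF assms]
  by (auto intro!: continuous_on_curve simp: o_def C1_def)

abbreviation dg :: "real \<Rightarrow> 'n \<Rightarrow> 'n \<Rightarrow> 'n \<Rightarrow> real" where
  "dg t l i j \<equiv> pd \<phi> l (\<lambda>q. g \<phi> q $ i $ j) (\<gamma> t)"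

text \<open>Two of the three terms of the first-kind symbols coincide after contraction with the
  symmetric product of u with itself. The result is polynomial in u, its derivative, the metric and
  its first derivatives, so it is visibly continuous.\<close>

lemma acceleration_flat:
  assumes "t \<in> T"
  shows "(g \<phi> (\<gamma> t) *v acceleration g \<phi> J \<gamma> t) $ l = (\<Sum>k\<in>UNIV. g \<phi> (\<gamma> t) $ l $ k * u_dot t $ k)
    + (\<Sum>i\<in>UNIV. \<Sum>j\<in>UNIV. (dg t i j l - dg t l i j / 2) * u t $ i * u t $ j)"
proof -
  let ?G = "\<lambda>k. g \<phi> (\<gamma> t) $ l $ k" and ?C = "\<lambda>k i j. christoffel g \<phi> k i j (\<gamma> t)"
  have "(\<Sum>k\<in>UNIV. ?G k * (\<Sum>i\<in>UNIV. \<Sum>j\<in>UNIV. ?C k i j * u t $ i * u t $ j)) =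
      (\<Sum>i\<in>UNIV. \<Sum>j\<in>UNIV. (\<Sum>k\<in>UNIV. ?G k * ?C k i j) * u t $ i * u t $ j)"
    unfolding sum_distrib_left sum_distrib_right
    by (subst sum.swap, rule sum.cong[OF refl], subst sum.swap) (simp add: mult.assoc)
  also have "\<dots> = (\<Sum>i\<in>UNIV. \<Sum>j\<in>UNIV. (dg t i j l / 2 - dg t l i j / 2) * u t $ i * u t $ j)
      + (\<Sum>i\<in>UNIV. \<Sum>j\<in>UNIV. dg t j i l / 2 * u t $ i * u t $ j)"
    unfolding christoffel_lower[OF T_D(2)[OF assms]] sum.distrib[symmetric]
    by (intro sum.cong refl) (simp add: algebra_simps add_divide_distrib diff_divide_distrib)
  also have "(\<Sum>i\<in>UNIV. \<Sum>j\<in>UNIV. dg t j i l / 2 * u t $ i * u t $ j) =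
      (\<Sum>i\<in>UNIV. \<Sum>j\<in>UNIV. dg t i j l / 2 * u t $ i * u t $ j)"
    by (subst sum.swap) (simp add: mult.assoc mult.commute[of "u t $ _" "u t $ _"])
  also have "(\<Sum>i\<in>UNIV. \<Sum>j\<in>UNIV. (dg t i j l / 2 - dg t l i j / 2) * u t $ i * u t $ j) + \<dots> =
      (\<Sum>i\<in>UNIV. \<Sum>j\<in>UNIV. (dg t i j l - dg t l i j / 2) * u t $ i * u t $ j)"
    unfolding sum.distrib[symmetric] by (intro sum.cong refl) (simp add: algebra_simps)
  finally show ?thesis
    by (simp add: acceleration_def matrix_vector_mult_def u_dot_def distrib_left sum.distrib)
qed

lemma continuous_on_acceleration_flat:
  "continuous_on T (\<lambda>t. (g \<phi> (\<gamma> t) *v acceleration g \<phi> J \<gamma> t) $ l)"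
proof (rule continuous_on_eq)
  \<comment> \<open>\<open>curve_derivatives\<close> asks for a point of \<open>T\<close> even in
    its third conclusion, hence the separate case of empty \<open>T\<close>.\<close>
  have "continuous_on T u_dot"
    using curve_derivatives(3) by (cases "T = {}") auto
  then show "continuous_on T (\<lambda>t. (\<Sum>k\<in>UNIV. g \<phi> (\<gamma> t) $ l $ k * u_dot t $ k)
    + (\<Sum>i\<in>UNIV. \<Sum>j\<in>UNIV. (dg t i j l - dg t l i j / 2) * u t $ i * u t $ j))"
    by (intro continuous_intros continuous_on_C1_curve C1_metric continuous_on_component continuous_on_u) auto
qed (simp add: acceleration_flat)

lemma continuous_on_u_flat: "continuous_on T (\<lambda>t. u_flat t $ l)"
  unfolding u_flat_def matrix_vector_mult_def vec_lambda_beta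
  by (intro continuous_intros continuous_on_C1_curve C1_metric continuous_on_component continuous_on_u)

lemma continuous_on_sq: "continuous_on T sq"
  unfolding sq_def inner_vec_def inner_real_def
  by (intro continuous_intros continuous_on_u_flat continuous_on_component continuous_on_u)

lemma continuous_on_christoffel_trace:
  "continuous_on T (\<lambda>t. christoffel_trace g \<phi> i (\<gamma> t))"
proof (rule continuous_on_eq)
  show "continuous_on T (\<lambda>t. (\<Sum>k\<in>UNIV. \<Sum>l\<in>UNIV. matrix_inv (g \<phi> (\<gamma> t)) $ k $ l * dg t i l k) / 2)"
    by (intro continuous_intros continuous_on_C1_curve C1_metric continuous_on_matrix_inv_component metric_det T_D) auto
qed (simp add: christoffel_trace_eq T_D)

lemma continuous_on_nabla_density:
  assumes "C1 \<phi> s"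
  shows "continuous_on T (\<lambda>t. nabla_density w g \<phi> s i (\<gamma> t))"
  unfolding nabla_density_def
  by (intro continuous_intros continuous_on_C1_curve assms continuous_on_christoffel_trace)

text \<open>Metric compatibility of the Levi-Civita connection: the covariant derivative along the
  curve commutes with lowering the index, so the lowered velocity has the lowered acceleration as
  its derivative once the Christoffel correction is moved to the right.\<close>

lemma u_flat_derivative:
  assumes "t \<in> T"
  shows "(u_flat has_vector_derivative g \<phi> (\<gamma> t) *v acceleration g \<phi> J \<gamma> t
    + (\<chi> j. \<Sum>i\<in>UNIV. \<Sum>k\<in>UNIV. christoffel g \<phi> k i j (\<gamma> t) * u t $ i * u_flat t $ k)) (at t within J)"
proof -
  note p = T_D(2)[OF assms]
  let ?G = "\<lambda>k l. g \<phi> (\<gamma> t) $ k $ l" and ?C = "\<lambda>k i j. christoffel g \<phi> k i j (\<gamma> t)"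
  define D where "D = (\<lambda>j. \<Sum>k\<in>UNIV. ?G j k * u_dot t $ k + (\<Sum>i\<in>UNIV. u t $ i * dg t i j k) * u t $ k)"
  have u: "((\<lambda>r. u r $ k) has_vector_derivative u_dot t $ k) (at t within J)" for k
    by (rule bounded_linear.has_vector_derivative[OF bounded_linear_vec_nth curve_derivatives(2)[OF assms]])
  have comp: "((\<lambda>r. u_flat r $ j) has_vector_derivative D j) (at t within J)" for j
    unfolding u_flat_def matrix_vector_mult_def vec_lambda_beta D_def
    by (intro has_vector_derivative_sum has_vector_derivative_mult u
        derivative_along_curve[OF assms diff_metric[OF p]])
  \<comment> \<open>Contraction with u twice kills the part of the first-kind symbol antisymmetric
    in i and l. The surviving half cancels against the last term of
    \<open>acceleration_flat\<close>.\<close>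
  have "(\<Sum>i\<in>UNIV. \<Sum>k\<in>UNIV. ?C k i j * u t $ i * u_flat t $ k) =
      (\<Sum>i\<in>UNIV. \<Sum>l\<in>UNIV. dg t j i l / 2 * u t $ i * u t $ l)" for j
  proof -
    have "(\<Sum>k\<in>UNIV. ?C k i j * u t $ i * u_flat t $ k) =
        (\<Sum>l\<in>UNIV. (\<Sum>k\<in>UNIV. ?G l k * ?C k i j) * u t $ i * u t $ l)" for i
      unfolding u_flat_def matrix_vector_mult_def vec_lambda_beta sum_distrib_left sum_distrib_right
      by (subst sum.swap) (intro sum.cong refl, simp add: metric_sym[OF p] ac_simps)
    then have "(\<Sum>i\<in>UNIV. \<Sum>k\<in>UNIV. ?C k i j * u t $ i * u_flat t $ k) =
        (\<Sum>i\<in>UNIV. \<Sum>l\<in>UNIV. dg t j i l / 2 * u t $ i * u t $ l)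
        + ((\<Sum>i\<in>UNIV. \<Sum>l\<in>UNIV. dg t i j l / 2 * u t $ i * u t $ l)
        - (\<Sum>i\<in>UNIV. \<Sum>l\<in>UNIV. dg t l i j / 2 * u t $ i * u t $ l))"
      unfolding christoffel_lower[OF p] sum.distrib[symmetric] sum_subtractf[symmetric]
      by (simp, intro sum.cong refl) (simp add: algebra_simps add_divide_distrib diff_divide_distrib)
    also have "(\<Sum>i\<in>UNIV. \<Sum>l\<in>UNIV. dg t i j l / 2 * u t $ i * u t $ l) =
        (\<Sum>i\<in>UNIV. \<Sum>l\<in>UNIV. dg t l i j / 2 * u t $ i * u t $ l)"
      by (subst sum.swap, intro sum.cong refl)
        (simp add: pd_metric_sym[OF p, of _ j] mult.assoc mult.commute[of "u t $ _" "u t $ _"])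
    finally show ?thesis by simp
  qed
  note C = this
  have "D j = (g \<phi> (\<gamma> t) *v acceleration g \<phi> J \<gamma> t
    + (\<chi> j. \<Sum>i\<in>UNIV. \<Sum>k\<in>UNIV. ?C k i j * u t $ i * u_flat t $ k)) $ j" for j
  proof -
    have "(\<Sum>k\<in>UNIV. (\<Sum>i\<in>UNIV. u t $ i * dg t i j k) * u t $ k) =
       (\<Sum>i\<in>UNIV. \<Sum>k\<in>UNIV. dg t i k j * u t $ i * u t $ k)"
      unfolding sum_distrib_right
      by (subst sum.swap, intro sum.cong refl) (simp add: pd_metric_sym[OF p, of _ j] ac_simps)
    then show ?thesis
      unfolding vector_add_component vec_lambda_beta C acceleration_flat[OF assms] D_def sum.distrib
      by (simp add: sum.distrib[symmetric] algebra_simps)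
  qed
  then show ?thesis
    unfolding has_vector_derivative_def has_derivative_componentwise_within[of u_flat]
    using comp by (auto simp: Basis_vec_def inner_axis has_vector_derivative_def)
qed

end

section \<open>Antisymmetrisation\<close>

lemma antisym_3_eq:
  fixes F :: "'i \<Rightarrow> 'i \<Rightarrow> 'i \<Rightarrow> real"
  shows "antisym 3 (\<lambda>i. F (i 0) (i 1) (i 2)) i =
    (F (i 0) (i 1) (i 2) - F (i 0) (i 2) (i 1) + F (i 1) (i 2) (i 0)
     - F (i 1) (i 0) (i 2) + F (i 2) (i 0) (i 1) - F (i 2) (i 1) (i 0)) / 6"
proof -
  have *: "{..<3} = insert 0 (insert 1 {2::nat})" by auto
  have f: "finite {1, 2::nat}" "0 \<notin> {1, 2::nat}" "finite {2::nat}" "1 \<notin> {2::nat}" by auto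
  show ?thesis
    unfolding antisym_def * sum_over_permutations_insert[OF f(1,2)]
      sum_over_permutations_insert[OF f(3,4)] permutes_sing
    by (simp add: sign_swap_id sign_compose permutation_swap_id sign_id fact_numeral
        Transposition.transpose_def algebra_simps)
qed

text \<open>The list consists of the twelve even permutations; each odd one arises from exactly one
  of them by exchanging the last two entries.\<close>

lemma antisym_4_eq:
  fixes F :: "'i \<Rightarrow> 'i \<Rightarrow> 'i \<Rightarrow> 'i \<Rightarrow> real"
  shows "antisym 4 (\<lambda>i. F (i 0) (i 1) (i 2) (i 3)) i =
    (\<Sum>(a, b, c, d) \<leftarrow> [(0,1,2,3), (0,2,3,1), (0,3,1,2), (1,0,3,2), (1,2,0,3), (1,3,2,0),
        (2,0,1,3), (2,1,3,0), (2,3,0,1), (3,0,2,1), (3,1,0,2), (3,2,1,0)].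
      F (i a) (i b) (i c) (i d) - F (i a) (i b) (i d) (i c)) / 24"
proof -
  have *: "{..<4} = insert 0 (insert 1 (insert 2 {3::nat}))" by auto
  have f: "finite {1, 2, 3::nat}" "0 \<notin> {1, 2, 3::nat}" "finite {2, 3::nat}" "1 \<notin> {2, 3::nat}"
    "finite {3::nat}" "2 \<notin> {3::nat}" by auto
  show ?thesis
    unfolding antisym_def * sum_over_permutations_insert[OF f(1,2)]
      sum_over_permutations_insert[OF f(3,4)] sum_over_permutations_insert[OF f(5,6)] permutes_sing
    by (simp add: sign_swap_id sign_compose permutation_swap_id permutation_compose sign_id fact_numeral
        Transposition.transpose_def algebra_simps)
qed

text \<open>The wedge product of linearly dependent vectors vanishes. The scalar \<open>k\<close>
  leaves room for the normalisation of the 3-tractor.\<close>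

lemma antisym_4_dependent:
  fixes V X Y Z :: "'a \<Rightarrow> real"
  assumes "\<And>a. V a = x * X a + y * Y a + z * Z a"
  shows "antisym 4 (\<lambda>i. V (i 0) * (k * antisym 3 (\<lambda>i. X (i 0) * Y (i 1) * Z (i 2)) (i \<circ> Suc))) i = 0"
proof -
  \<comment> \<open>The inner antisymmetrisation is written out with its slots shifted by one, which
    brings the whole expression into the form expected by \<open>antisym_4_eq\<close>.\<close>
  define F where "F = (\<lambda>a b c d. k / 6 * (V a * (X b * Y c * Z d - X b * Y d * Z c + X c * Y d * Z b
     - X c * Y b * Z d + X d * Y b * Z c - X d * Y c * Z b)))"
  have "V (i 0) * (k * antisym 3 (\<lambda>i. X (i 0) * Y (i 1) * Z (i 2)) (i \<circ> Suc)) =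
      F (i 0) (i 1) (i 2) (i 3)" for i :: "nat \<Rightarrow> 'a"
    unfolding antisym_3_eq[where F = "\<lambda>a b c. X a * Y b * Z c"] F_def
    by (simp add: numeral_2_eq_2 numeral_3_eq_3)
  then show ?thesis
    by (simp only: antisym_4_eq) (simp add: F_def assms algebra_simps)
qed

section \<open>The 3-tractor and the scale tractor\<close>

locale conformal_chart_curve = chart_curve M \<phi> g J \<gamma>
  for M :: "'m topology" and \<phi> :: "('m, 'n::finite) chart" and g :: "('m, 'n) metric_field"
    and J :: "real set" and \<gamma> :: "real \<Rightarrow> 'm" +
  fixes c :: "('m, 'n) metric_field set" and \<sigma> :: "('m, 'n) density_field"
  assumes conf_metric_eq: "\<And>q. q \<in> dom \<phi> \<Longrightarrow> conf_metric c \<phi> q = (scale_density g \<phi> q)\<^sup>2 *\<^sub>R g \<phi> q"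
    and C1_sigma: "C1 \<phi> (\<sigma> \<phi>)"
begin

abbreviation a_flat :: "real \<Rightarrow> real^'n" where
  "a_flat t \<equiv> g \<phi> (\<gamma> t) *v acceleration g \<phi> J \<gamma> t"

definition grad_sigma :: "real \<Rightarrow> real^'n" where
  "grad_sigma t = (\<chi> i. nabla_density 1 g \<phi> (\<sigma> \<phi>) i (\<gamma> t))"

text \<open>Where \<open>\<sigma> \<noteq> 0\<close>, this is \<open>\<sigma>\<close> times the lowered acceleration for \<open>\<sigma>\<^sup>-\<^sup>2\<close> times the conformal
  metric, up to a multiple of the lowered velocity; unlike that acceleration, it is continuous across
  the zero locus.\<close>

definition W :: "real \<Rightarrow> real^'n" where
  "W t = sq t *\<^sub>R grad_sigma t + \<sigma> \<phi> (\<gamma> t) *\<^sub>R a_flat t"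

lemma u_conf_metric:
  assumes "t \<in> T"
  shows "u t v* conf_metric c \<phi> (\<gamma> t) = (scale_density g \<phi> (\<gamma> t))\<^sup>2 *\<^sub>R u_flat t"
    "conf_metric c \<phi> (\<gamma> t) *v u t = (scale_density g \<phi> (\<gamma> t))\<^sup>2 *\<^sub>R u_flat t"
  using metric_sym[OF T_D(2)[OF assms]]
  by (simp_all add: conf_metric_eq T_D[OF assms] u_flat_def vec_eq_iff vector_matrix_mult_def
      matrix_vector_mult_def sum_distrib_left ac_simps)

lemma sigma_u_eq:
  assumes "t \<in> T"
  shows "sigma_u c \<phi> J \<gamma> t = scale_density g \<phi> (\<gamma> t) * sqrt (sq t)"
  using sq_pos[OF assms] scale_density_pos[OF T_D(2)[OF assms]]
  by (simp add: sigma_u_def u_conf_metric[OF assms] sq_def[symmetric] abs_mult real_sqrt_mult)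

lemma sigma_u_pos: "t \<in> T \<Longrightarrow> sigma_u c \<phi> J \<gamma> t > 0"
  using sq_pos scale_density_pos T_D by (simp add: sigma_u_eq)

text \<open>Contracted twice with u, each Kronecker delta in \<open>christoffel_singular\<close>
  yields a multiple of u, and the metric term yields \<open>sq t\<close> times the raised gradient.
  Multiplying by \<sigma> and lowering the index gives \<open>W\<close>.\<close>

lemma W_parallel_off_zero_locus:
  assumes t: "t \<in> T" and "\<sigma> \<phi> (\<gamma> t) \<noteq> 0"
    and k: "acceleration (singular_metric c \<sigma>) \<phi> J \<gamma> t = k *\<^sub>R u t"
  shows "\<exists>r. W t = r *\<^sub>R u_flat t"
proof -
  note p = T_D(2)[OF t]
  let ?s = "\<sigma> \<phi> (\<gamma> t)" and ?B = "g \<phi> (\<gamma> t)" and ?N = "grad_sigma t"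
  define m where "m = ?N \<bullet> u t"
  have h: "singular_metric c \<sigma> \<phi> q = (inverse ((\<sigma> \<phi> q)\<^sup>2) * (scale_density g \<phi> q)\<^sup>2) *\<^sub>R g \<phi> q"
    if "q \<in> dom \<phi>" for q
    using that by (simp add: singular_metric_def conf_metric_eq)
  have s: "diff_at \<phi> (\<gamma> t) (\<sigma> \<phi>)" using C1_sigma p by (simp add: C1_def)
  note C = christoffel_singular[of "\<gamma> t" "singular_metric c \<sigma>" "\<sigma> \<phi>", OF p h s assms(2)]
  have "acceleration (singular_metric c \<sigma>) \<phi> J \<gamma> t =
      acceleration g \<phi> J \<gamma> t - (1 / ?s) *\<^sub>R ((2 * m) *\<^sub>R u t - sq t *\<^sub>R (matrix_inv ?B *v ?N))"
  proof (rule vec_eq_iff[THEN iffD2, rule_format])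
    fix k
    define V where "V = (\<Sum>l\<in>UNIV. matrix_inv ?B $ k $ l * ?N $ l)"
    have "(\<Sum>i\<in>UNIV. \<Sum>j\<in>UNIV. christoffel (singular_metric c \<sigma>) \<phi> k i j (\<gamma> t) * u t $ i * u t $ j) =
       (\<Sum>i\<in>UNIV. \<Sum>j\<in>UNIV. christoffel g \<phi> k i j (\<gamma> t) * u t $ i * u t $ j) -
       ((\<Sum>i\<in>UNIV. \<Sum>j\<in>UNIV. (if k = j then ?N $ i else 0) * u t $ i * u t $ j)
        + (\<Sum>i\<in>UNIV. \<Sum>j\<in>UNIV. (if k = i then ?N $ j else 0) * u t $ i * u t $ j)
        - (\<Sum>i\<in>UNIV. \<Sum>j\<in>UNIV. u t $ i * (?B $ i $ j * u t $ j)) * V) / ?s"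
      unfolding sum_divide_distrib sum_distrib_right sum.distrib[symmetric] sum_subtractf[symmetric]
      by (intro sum.cong refl) (simp only: C grad_sigma_def vec_lambda_beta V_def,
          simp add: diff_divide_distrib add_divide_distrib algebra_simps)
    also have "(\<Sum>i\<in>UNIV. \<Sum>j\<in>UNIV. (if k = j then ?N $ i else 0) * u t $ i * u t $ j) = m * u t $ k"
      by (simp add: m_def inner_vec_def if_distrib if_distribR sum_distrib_right cong: if_cong)
    also have "(\<Sum>i\<in>UNIV. \<Sum>j\<in>UNIV. (if k = i then ?N $ j else 0) * u t $ i * u t $ j) =
        (\<Sum>i\<in>UNIV. if k = i then m * u t $ i else 0)"
      by (rule sum.cong) (auto simp: m_def inner_vec_def sum_distrib_right intro!: sum.cong)
    also have "(\<Sum>i\<in>UNIV. \<Sum>j\<in>UNIV. u t $ i * (?B $ i $ j * u t $ j)) = sq t"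
      by (simp add: sq_def u_flat_def inner_vec_def matrix_vector_mult_def sum_distrib_left)
    finally show "acceleration (singular_metric c \<sigma>) \<phi> J \<gamma> t $ k = (acceleration g \<phi> J \<gamma> t
        - (1 / ?s) *\<^sub>R ((2 * m) *\<^sub>R u t - sq t *\<^sub>R (matrix_inv ?B *v ?N))) $ k"
      by (simp add: acceleration_def V_def matrix_vector_mult_def divide_inverse algebra_simps)
  qed
  then have "?s *\<^sub>R (k *\<^sub>R u t) = ?s *\<^sub>R acceleration g \<phi> J \<gamma> t - ((2 * m) *\<^sub>R u t - sq t *\<^sub>R (matrix_inv ?B *v ?N))"
    unfolding k using assms(2) by (simp add: scaleR_diff_right[of ?s])
  then have "?s *\<^sub>R acceleration g \<phi> J \<gamma> t + sq t *\<^sub>R (matrix_inv ?B *v ?N) = (?s * k + 2 * m) *\<^sub>R u t"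
    by (simp add: algebra_simps)
  then have "?B *v (?s *\<^sub>R acceleration g \<phi> J \<gamma> t + sq t *\<^sub>R (matrix_inv ?B *v ?N))
      = ?B *v ((?s * k + 2 * m) *\<^sub>R u t)"
    by (rule arg_cong)
  then have "W t = (?s * k + 2 * m) *\<^sub>R u_flat t"
    by (simp add: W_def u_flat_def matrix_vector_right_distrib matrix_vector_mult_scaleR
        matrix_vector_mul_assoc matrix_inv_mult[OF metric_det[OF p]] add.commute)
  then show ?thesis by blast
qed

text \<open>Proportionality with an unknown factor \<open>r\<close> is not visibly a closed
  condition, so it is replaced by the vanishing of the 2 by 2 minors \<open>F i j\<close> of the
  pair, which are continuous on \<open>T\<close>.\<close>

lemma W_parallel:
  assumes dense: "D \<subseteq> J" "J \<subseteq> closure D"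
    and geodesic: "\<And>t. t \<in> T \<Longrightarrow> t \<in> D \<Longrightarrow> \<exists>r. W t = r *\<^sub>R u_flat t"
    and t: "t \<in> T"
  shows "\<exists>r. W t = r *\<^sub>R u_flat t"
proof -
  define F where "F = (\<lambda>i j t. W t $ i * u_flat t $ j - W t $ j * u_flat t $ i)"
  have "continuous_on T (F i j)" for i j
    unfolding F_def W_def grad_sigma_def vector_add_component vector_scaleR_component vec_lambda_beta
    by (intro continuous_intros continuous_on_sq continuous_on_nabla_density C1_sigma
        continuous_on_C1_curve continuous_on_acceleration_flat continuous_on_u_flat)
  then have "closedin (top_of_set T) {s \<in> T. F i j s = 0}" for i j
    by (rule continuous_closedin_preimage_constant)
  then obtain K where K: "\<And>i j. closed (K i j) \<and> {s \<in> T. F i j s = 0} = T \<inter> K i j"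
    unfolding closedin_closed by metis
  obtain O' where O': "open O'" "T = J \<inter> O'" using T_relatively_open by blast
  have "F i j t = 0" for i j
  proof -
    \<comment> \<open>Cutting \<open>D\<close> down by the open set \<open>O'\<close> keeps the
      approximating parameters inside \<open>T\<close>, the only place where the minors are
      controlled.\<close>
    have "t \<in> O' \<inter> closure D" using t O' dense by auto
    then have "t \<in> closure (O' \<inter> D)" using open_Int_closure_subset[OF O'(1)] by blast
    moreover have "O' \<inter> D \<subseteq> K i j"
    proof
      fix s assume "s \<in> O' \<inter> D"
      then have s: "s \<in> T" "s \<in> D" using O' dense(1) by auto
      then obtain r where "W s = r *\<^sub>R u_flat s" using geodesic by blast
      then have "F i j s = 0" by (simp add: F_def)
      with s K show "s \<in> K i j" by blast
    qed
    ultimately have "t \<in> K i j" using K closure_minimal by blast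
    with t K show ?thesis by blast
  qed
  then have F: "W t $ i * u_flat t $ j = W t $ j * u_flat t $ i" for i j by (simp add: F_def)
  \<comment> \<open>Pairing the vanishing minors with u recovers the factor, since u pairs with
    \<open>u_flat t\<close> to \<open>sq t\<close>, which is positive by definiteness.\<close>
  have "sq t * W t $ i = (W t \<bullet> u t) * u_flat t $ i" for i
    unfolding sq_def inner_vec_def sum_distrib_right using F[of i]
    by (intro sum.cong refl) (simp add: ac_simps)
  then have "W t = ((W t \<bullet> u t) / sq t) *\<^sub>R u_flat t"
    using sq_pos[OF t] by (simp add: vec_eq_iff field_simps)
  then show ?thesis by blast
qed


text \<open>The factor by which the weighted lowered velocity differs from \<open>u_flat\<close>.\<close>

definition wt :: "real \<Rightarrow> real" where
  "wt t = scale_density g \<phi> (\<gamma> t) / sqrt (sq t)"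

text \<open>For a multiple of X, the tractor connection reaches the middle slot only through the
  term \<rho> times the conformal metric. Here \<rho> is the inverse of \<open>sigma_u\<close>, and
  writing the conformal metric in the scale \<open>g\<close> leaves the factor
  \<open>wt\<close>.\<close>

lemma U_tractor_eq:
  assumes "t \<in> T"
  shows "fst (U_tractor c g \<phi> J \<gamma> t) = 0" "fst (snd (U_tractor c g \<phi> J \<gamma> t)) = wt t *\<^sub>R u_flat t"
proof -
  note d = at_within_J_nontrivial[OF assms]
  have "vector_derivative (\<lambda>r. 0 :: real) (at t within J) = 0"
    "vector_derivative (\<lambda>r. 0 :: real^'n) (at t within J) = 0"
    by (rule vector_derivative_within[OF d has_vector_derivative_const])+
  then show "fst (U_tractor c g \<phi> J \<gamma> t) = 0" "fst (snd (U_tractor c g \<phi> J \<gamma> t)) = wt t *\<^sub>R u_flat t"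
    using sigma_u_pos[OF assms] sq_pos[OF assms] scale_density_pos[OF T_D(2)[OF assms]]
    by (simp_all add: U_tractor_def weighted_tractor_nabla_def tractor_nabla_def Let_def X_tractor_def
      curve_nabla_density_def curve_nabla_form_def u_conf_metric[OF assms] zero_vec_def[symmetric]
      wt_def sigma_u_eq[OF assms] power2_eq_square field_simps)
qed

lemma wt_mult_sq:
  assumes "t \<in> T"
  shows "wt t * sq t = sigma_u c \<phi> J \<gamma> t"
proof -
  have "wt t * sq t = scale_density g \<phi> (\<gamma> t) * (sq t / sqrt (sq t))"
    by (simp add: wt_def)
  then show ?thesis
    using sq_pos[OF assms] by (simp only: real_div_sqrt less_imp_le sigma_u_eq[OF assms])
qed

text \<open>The value of the derivative is left open: in the derivative of U it multiplies
  \<open>u_flat\<close> and is absorbed by the free coefficient in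
  \<open>A_tractor_eq\<close>.\<close>

lemma wt_differentiable:
  assumes "t \<in> T"
  shows "\<exists>D. (wt has_vector_derivative D) (at t within J)"
proof -
  have "((\<lambda>r. u r \<bullet> u_flat r) has_derivative
     (\<lambda>h. u t \<bullet> (h *\<^sub>R (a_flat t + (\<chi> j. \<Sum>i\<in>UNIV. \<Sum>k\<in>UNIV. christoffel g \<phi> k i j (\<gamma> t) * u t $ i * u_flat t $ k)))
        + (h *\<^sub>R u_dot t) \<bullet> u_flat t)) (at t within J)"
    using has_derivative_inner[OF curve_derivatives(2)[OF assms, unfolded has_vector_derivative_def]
      u_flat_derivative[OF assms, unfolded has_vector_derivative_def]] .
  then have "sq differentiable (at t within J)"
    unfolding sq_def[abs_def] differentiable_def by blast
  then obtain q where q: "(sq has_real_derivative q) (at t within J)"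
    by (auto simp: real_differentiable_def)
  have "((\<lambda>r. scale_density g \<phi> (\<gamma> r)) has_real_derivative
      (\<Sum>i\<in>UNIV. u t $ i * pd \<phi> i (scale_density g \<phi>) (\<gamma> t))) (at t within J)"
    using derivative_along_curve[OF assms diff_scale_density(1)[OF T_D(2)[OF assms]]]
    by (simp add: has_real_derivative_iff_has_vector_derivative)
  then have "\<exists>D. (wt has_real_derivative D) (at t within J)"
    unfolding wt_def[abs_def]
    using q sq_pos[OF assms] by (fastforce intro!: derivative_eq_intros)
  then show ?thesis
    by (simp add: has_real_derivative_iff_has_vector_derivative)
qed

text \<open>In the top slot the derivative of 0 leaves minus the pairing of u with the middle slot
  of U. In the middle slot the Christoffel correction cancels by \<open>u_flat_derivative\<close>;
  the weight term, the derivative of \<open>wt\<close> and the last slot of U all contribute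
  multiples of \<open>u_flat\<close>.\<close>

lemma A_tractor_eq:
  assumes "t \<in> T"
  shows "fst (A_tractor c g \<phi> J \<gamma> t) = - sigma_u c \<phi> J \<gamma> t"
    "\<exists>r. fst (snd (A_tractor c g \<phi> J \<gamma> t)) = wt t *\<^sub>R a_flat t + r *\<^sub>R u_flat t"
proof -
  note d = at_within_J_nontrivial[OF assms] and U = U_tractor_eq
  have A: "A_tractor c g \<phi> J \<gamma> t = tractor_nabla c g \<phi> J \<gamma> (U_tractor c g \<phi> J \<gamma>) t"
    using sigma_u_pos[OF assms] by (simp add: A_tractor_def weighted_tractor_nabla_def)
  have "((\<lambda>r. fst (U_tractor c g \<phi> J \<gamma> r)) has_vector_derivative 0) (at t within J)"
    by (rule has_vector_derivative_cong_T[OF assms has_vector_derivative_const[of 0]]) (simp add: U)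
  note d0 = vector_derivative_within[OF d this]
  show "fst (A_tractor c g \<phi> J \<gamma> t) = - sigma_u c \<phi> J \<gamma> t"
    using sq_pos[OF assms] unfolding A
    by (simp add: tractor_nabla_def Let_def curve_nabla_density_def d0 U[OF assms] sq_def[symmetric]
      wt_mult_sq[OF assms])
  let ?C = "\<chi> j. \<Sum>i\<in>UNIV. \<Sum>k\<in>UNIV. christoffel g \<phi> k i j (\<gamma> t) * u t $ i * u_flat t $ k"
  obtain w where w: "(wt has_vector_derivative w) (at t within J)" using wt_differentiable[OF assms] by blast
  have "((\<lambda>r. wt r *\<^sub>R u_flat r) has_vector_derivative (wt t *\<^sub>R (a_flat t + ?C) + w *\<^sub>R u_flat t)) (at t within J)"
    by (rule has_vector_derivative_scaleR[OF _ u_flat_derivative[OF assms]])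
      (use w in \<open>simp add: has_real_derivative_iff_has_vector_derivative\<close>)
  then have "((\<lambda>r. fst (snd (U_tractor c g \<phi> J \<gamma> r))) has_vector_derivative
      (wt t *\<^sub>R (a_flat t + ?C) + w *\<^sub>R u_flat t)) (at t within J)"
    by (rule has_vector_derivative_cong_T[OF assms]) (simp add: U)
  note d1 = vector_derivative_within[OF d this]
  have C: "(\<chi> j. \<Sum>i\<in>UNIV. \<Sum>k\<in>UNIV. christoffel g \<phi> k i j (\<gamma> t) * u t $ i * (wt t *\<^sub>R u_flat t) $ k) = wt t *\<^sub>R ?C"
    by (simp add: vec_eq_iff sum_distrib_left ac_simps)
  have "\<exists>r. curve_nabla_form 1 g \<phi> J \<gamma> (\<lambda>r. fst (snd (U_tractor c g \<phi> J \<gamma> r))) t = wt t *\<^sub>R a_flat t + r *\<^sub>R u_flat t"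
    unfolding curve_nabla_form_def d1 U(2)[OF assms] C
    by (rule exI[of _ "w + 1 / real CARD('n) * (\<Sum>i\<in>UNIV. u t $ i * christoffel_trace g \<phi> i (\<gamma> t)) * wt t"])
      (simp add: algebra_simps)
  then obtain r where r: "curve_nabla_form 1 g \<phi> J \<gamma> (\<lambda>r. fst (snd (U_tractor c g \<phi> J \<gamma> r))) t = wt t *\<^sub>R a_flat t + r *\<^sub>R u_flat t"
    by blast
  show "\<exists>r. fst (snd (A_tractor c g \<phi> J \<gamma> t)) = wt t *\<^sub>R a_flat t + r *\<^sub>R u_flat t"
    unfolding A
    by (rule exI[of _ "r + snd (snd (U_tractor c g \<phi> J \<gamma> t)) * (scale_density g \<phi> (\<gamma> t))\<^sup>2"])
      (simp add: tractor_nabla_def Let_def r U[OF assms] u_conf_metric[OF assms] algebra_simps)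
qed

lemma scale_tractor_in_span:
  assumes t: "t \<in> T" and W: "W t = r *\<^sub>R u_flat t"
  shows "\<exists>x y z. scale_tractor c \<sigma> g \<phi> (\<gamma> t) =
    x *\<^sub>R X_tractor + y *\<^sub>R U_tractor c g \<phi> J \<gamma> t + z *\<^sub>R A_tractor c g \<phi> J \<gamma> t"
proof -
  let ?I = "scale_tractor c \<sigma> g \<phi> (\<gamma> t)" and ?U = "U_tractor c g \<phi> J \<gamma> t" and ?A = "A_tractor c g \<phi> J \<gamma> t"
  let ?s = "sigma_u c \<phi> J \<gamma> t"
  obtain l where l: "fst (snd ?A) = wt t *\<^sub>R a_flat t + l *\<^sub>R u_flat t"
    using A_tractor_eq(2)[OF t] by blast
  have q: "sq t > 0" "?s > 0" "wt t > 0" "?s = wt t * sq t"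
    using sq_pos[OF t] sigma_u_pos[OF t] scale_density_pos[OF T_D(2)[OF t]] wt_mult_sq[OF t]
    by (simp_all add: wt_def)
  \<comment> \<open>The coefficients are solved for slot by slot: \<open>z\<close> from the top
    slot, where X and U vanish, then \<open>y\<close> from the middle slot by means of
    \<open>W\<close>, while \<open>x\<close> takes up whatever remains in the last slot.\<close>
  define z where "z = - \<sigma> \<phi> (\<gamma> t) / ?s"
  define y where "y = (r / sq t - z * l) / wt t"
  define x where "x = snd (snd ?I) - y * snd (snd ?U) - z * snd (snd ?A)"
  have "fst ?I = \<sigma> \<phi> (\<gamma> t)" "fst (snd ?I) = grad_sigma t"
    by (simp_all add: scale_tractor_def grad_sigma_def)
  moreover have "grad_sigma t = (y * wt t + z * l) *\<^sub>R u_flat t + (z * wt t) *\<^sub>R a_flat t"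
  proof -
    have "sq t *\<^sub>R grad_sigma t = r *\<^sub>R u_flat t - \<sigma> \<phi> (\<gamma> t) *\<^sub>R a_flat t"
      using W by (simp add: W_def algebra_simps)
    then have "(1 / sq t) *\<^sub>R (sq t *\<^sub>R grad_sigma t) = (1 / sq t) *\<^sub>R (r *\<^sub>R u_flat t - \<sigma> \<phi> (\<gamma> t) *\<^sub>R a_flat t)"
      by (rule arg_cong)
    then have "grad_sigma t = (r / sq t) *\<^sub>R u_flat t + (- \<sigma> \<phi> (\<gamma> t) / sq t) *\<^sub>R a_flat t"
      using q(1) by (simp add: scaleR_diff_right)
    moreover have "y * wt t + z * l = r / sq t" "z * wt t = - \<sigma> \<phi> (\<gamma> t) / sq t"
      using q by (auto simp: y_def z_def)
    ultimately show ?thesis by (simp only:)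
  qed
  ultimately have "?I = x *\<^sub>R X_tractor + y *\<^sub>R ?U + z *\<^sub>R ?A"
    using q(2)
    by (simp add: prod_eq_iff X_tractor_def U_tractor_eq[OF t] A_tractor_eq(1)[OF t] l x_def algebra_simps)
      (simp add: z_def)
  then show ?thesis by blast
qed

lemma wedge_I_Sigma_zero:
  assumes t: "t \<in> T" and W: "W t = r *\<^sub>R u_flat t"
  shows "wedge_I_Sigma c \<sigma> g \<phi> J \<gamma> t i = 0"
proof -
  have lin: "component (V + V') i = component V i + component V' i" "component (r *\<^sub>R V) i = r * component V i"
    for V V' :: "'n tractor" and r i
    by (cases V; cases V'; cases i; simp)+
  obtain x y z where "scale_tractor c \<sigma> g \<phi> (\<gamma> t) =
    x *\<^sub>R X_tractor + y *\<^sub>R U_tractor c g \<phi> J \<gamma> t + z *\<^sub>R A_tractor c g \<phi> J \<gamma> t"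
    using scale_tractor_in_span[OF assms] by blast
  then show ?thesis
    unfolding wedge_I_Sigma_def three_tractor_def
    by (intro antisym_4_dependent[where x = x and y = y and z = z]) (simp add: lin)
qed

end

section \<open>Scales of a conformal class\<close>

text \<open>The determinant scales by the n-th power of r, so the exponent -1/(2n), after squaring,
  produces 1/r and cancels the factor of the metric.\<close>

lemma scale_density_conformal:
  fixes g :: "('m, 'n::finite) metric_field"
  assumes "h \<phi> p = r *\<^sub>R g \<phi> p" "r > 0"
  shows "(scale_density h \<phi> p)\<^sup>2 *\<^sub>R h \<phi> p = (scale_density g \<phi> p)\<^sup>2 *\<^sub>R g \<phi> p"
proof -
  let ?n = "real CARD('n)"
  have "(r powr ?n) powr (- 1 / (2 * ?n)) = r powr (- 1 / 2)"
    by (simp add: powr_powr)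
  then have "(scale_density h \<phi> p)\<^sup>2 = (r powr (- 1 / 2))\<^sup>2 * (scale_density g \<phi> p)\<^sup>2"
    using assms by (simp add: scale_density_def det_scaleR abs_mult powr_mult powr_realpow power_mult_distrib)
  also have "(r powr (- 1 / 2))\<^sup>2 = inverse r"
    using assms(2) by (simp add: powr_minus powr_half_sqrt power_inverse)
  finally show ?thesis using assms by simp
qed

text \<open>\<open>conf_metric\<close> is built from an arbitrary member of the class. Comparing
  both that member and \<open>g\<close> with the base metric shows that it may be computed in the
  scale \<open>g\<close>.\<close>

lemma conformal_classE:
  assumes "conformal_class A c" "g \<in> c"
  obtains g0 \<omega> where "pseudo_riemannian_metric A g0" "smooth_function A \<omega>"
    "\<And>\<phi> p. \<phi> \<in> A \<Longrightarrow> p \<in> dom \<phi> \<Longrightarrow> g \<phi> p = exp (2 * \<omega> p) *\<^sub>R g0 \<phi> p"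
    "\<And>\<phi> p. \<phi> \<in> A \<Longrightarrow> p \<in> dom \<phi> \<Longrightarrow> conf_metric c \<phi> p = (scale_density g \<phi> p)\<^sup>2 *\<^sub>R g \<phi> p"
proof -
  obtain g0 where g0: "pseudo_riemannian_metric A g0"
    and c: "c = {g. \<exists>\<omega>. smooth_function A \<omega> \<and>
      (\<forall>\<phi>\<in>A. \<forall>p\<in>dom \<phi>. g \<phi> p = exp (2 * \<omega> p) *\<^sub>R g0 \<phi> p)}"
    using assms(1) unfolding conformal_class_def by blast
  have sd: "(scale_density h \<phi> p)\<^sup>2 *\<^sub>R h \<phi> p = (scale_density g0 \<phi> p)\<^sup>2 *\<^sub>R g0 \<phi> p"
    if "h \<in> c" "\<phi> \<in> A" "p \<in> dom \<phi>" for h \<phi> p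
    using that scale_density_conformal[of h \<phi> p _ g0] unfolding c by fastforce
  have "(SOME g. g \<in> c) \<in> c" by (rule someI[where P = "\<lambda>g. g \<in> c", OF assms(2)])
  then have cm: "conf_metric c \<phi> p = (scale_density g \<phi> p)\<^sup>2 *\<^sub>R g \<phi> p" if "\<phi> \<in> A" "p \<in> dom \<phi>" for \<phi> p
    using sd that assms(2) by (simp add: conf_metric_def Let_def)
  obtain \<omega> where "smooth_function A \<omega>" "\<And>\<phi> p. \<phi> \<in> A \<Longrightarrow> p \<in> dom \<phi> \<Longrightarrow> g \<phi> p = exp (2 * \<omega> p) *\<^sub>R g0 \<phi> p"
    using assms(2) unfolding c by blast
  then show thesis using that g0 cm by blast
qed

text \<open>The hypothesis asks for zeros on the image of the chart only, because in the induction
  step the derivative is known only there.\<close>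

lemma (in coordinate_chart) Ck_on_zero:
  assumes "\<And>x. x \<in> img \<phi> \<Longrightarrow> f x = (0 :: real)"
  shows "Ck_on k (img \<phi>) f"
  using assms
proof (induction k arbitrary: f)
  case 0
  then show ?case using continuous_on_eq[OF continuous_on_const[of _ "0::real"]] by auto
next
  case (Suc k)
  have D: "(f has_derivative (\<lambda>v. 0)) (at x within img \<phi>)" if "x \<in> img \<phi>" for x
    by (rule has_derivative_transform[OF that _ has_derivative_const[of 0]]) (use Suc in auto)
  then have "f differentiable_on img \<phi>"
    by (auto simp: differentiable_on_def differentiable_def)
  moreover have "Ck_on k (img \<phi>) (\<lambda>x. frechet_derivative f (at x within img \<phi>) b)" for b
    by (rule Suc.IH) (simp add: frechet_derivative_img[OF D])
  ultimately show ?case by simp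
qed

lemma conformal_class_nonempty:
  assumes "conformal_class A c" "\<And>\<phi>. \<phi> \<in> A \<Longrightarrow> chart_on M \<phi>"
  shows "c \<noteq> {}"
proof -
  have "smooth_function A (\<lambda>p. 0)"
    using coordinate_chart.Ck_on_zero[OF coordinate_chart.intro[OF assms(2)]]
    by (simp add: smooth_function_def smooth_on_def o_def)
  then show ?thesis
    using assms(1) unfolding conformal_class_def by fastforce
qed

text \<open>A member of \<open>c\<close> is specified only by its values as a positive multiple of
  the base metric on chart domains; regularity, symmetry and nondegeneracy are carried over from the
  base metric and the exponent.\<close>

lemma conformal_chart_curveI:
  assumes "almost_riemannian M A c \<sigma>" "smooth_curve M A J \<gamma>" "\<phi> \<in> A" "g \<in> c"
  shows "conformal_chart_curve M \<phi> g J \<gamma> c \<sigma>"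
proof -
  have 1: "chart_on M \<phi>" "conformal_class A c" "density_section A 1 \<sigma>" "positive_definite A g"
    using assms by (auto simp: almost_riemannian_def almost_pseudo_riemannian_def manifold_with_boundary_def)
  interpret coordinate_chart M \<phi> by unfold_locales (rule 1)
  obtain g0 \<omega> where g0: "pseudo_riemannian_metric A g0" "smooth_function A \<omega>"
    and g: "\<And>p. p \<in> dom \<phi> \<Longrightarrow> g \<phi> p = exp (2 * \<omega> p) *\<^sub>R g0 \<phi> p"
    and cm: "\<And>p. p \<in> dom \<phi> \<Longrightarrow> conf_metric c \<phi> p = (scale_density g \<phi> p)\<^sup>2 *\<^sub>R g \<phi> p"
    using conformal_classE[OF 1(2) assms(4)] assms(3) by metis
  have C1_g0: "C1 \<phi> (\<lambda>q. g0 \<phi> q $ i $ j)" for i j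
    by (rule smooth_on_imp_C1[of "g0 \<phi>", OF _ bounded_linear_compose[OF bounded_linear_vec_nth bounded_linear_vec_nth]])
      (use g0(1) assms(3) in \<open>simp add: pseudo_riemannian_metric_def\<close>)
  have C1_\<omega>: "C1 \<phi> \<omega>" and C1_\<sigma>: "C1 \<phi> (\<sigma> \<phi>)"
    by (rule smooth_on_imp_C1[OF _ bounded_linear_ident],
        use g0(2) 1(3) assms(3) in \<open>simp add: smooth_function_def density_section_def\<close>)+
  show ?thesis
  proof
    show "C1 \<phi> (\<lambda>q. g \<phi> q $ i $ j)" for i j
      by (rule C1_cong[OF _ C1_mult[OF C1_exp[OF C1_\<omega>, of 2] C1_g0[of i j]]]) (simp add: g)
    fix p assume p: "p \<in> dom \<phi>"
    have g0p: "transpose (g0 \<phi> p) = g0 \<phi> p" "det (g0 \<phi> p) \<noteq> 0"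
      using g0(1) assms(3) p unfolding pseudo_riemannian_metric_def by blast+
    have "g0 \<phi> p $ i $ j = g0 \<phi> p $ j $ i" for i j
      by (metis g0p(1) transpose_def vec_lambda_beta)
    then show "g \<phi> p $ i $ j = g \<phi> p $ j $ i" for i j
      by (simp add: g[OF p])
    show "det (g \<phi> p) \<noteq> 0"
      using g0p(2) by (simp add: g[OF p] det_scaleR)
  qed (use 1 assms cm C1_\<sigma> in \<open>auto simp: smooth_curve_def positive_definite_def\<close>)
qed

lemma zero_locus_iff:
  assumes "density_section A w s" "\<phi> \<in> A" "p \<in> dom \<phi>" "p \<in> topspace M"
  shows "p \<in> zero_locus M A s \<longleftrightarrow> s \<phi> p = 0"
proof -
  have "s \<psi> p = 0" if "s \<phi> p = 0" "\<psi> \<in> A" "p \<in> dom \<psi>" for \<psi>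
    using assms that unfolding density_section_def by (metis IntI mult_zero_right)
  then show ?thesis using assms by (auto simp: zero_locus_def)
qed

text \<open>The density hypothesis expresses that the curve is a geodesic off the zero locus in a
  substantial sense: \<open>unparam_geodesic_on\<close> holds vacuously for a curve that stays
  inside the zero locus.\<close>

theorem proposition2:
  fixes M :: "'m topology"
    and A :: "('m, 'n::finite) chart set"
    and c :: "('m, 'n) metric_field set"
    and \<sigma> :: "('m, 'n) density_field"
    and J :: "real set"
    and \<gamma> :: "real \<Rightarrow> 'm"
  assumes "CARD('n) \<ge> 3"
    and "almost_riemannian M A c \<sigma>"
    and "smooth_curve M A J \<gamma>"
    and "J \<subseteq> closure {t \<in> J. \<gamma> t \<notin> zero_locus M A \<sigma>}"
    and "unparam_geodesic_on A (topspace M - zero_locus M A \<sigma>) (singular_metric c \<sigma>) J \<gamma>"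
  shows "generalised_geodesic M A c \<sigma> J \<gamma>"
  unfolding generalised_geodesic_def nowhere_null_def
proof (intro conjI ballI impI allI)
  show "smooth_curve M A J \<gamma>" by fact
next
  fix \<phi> t assume t: "\<phi> \<in> A" "t \<in> J" "\<gamma> t \<in> dom \<phi>"
  \<comment> \<open>\<open>nowhere_null\<close> names no scale, whereas positivity of the squared
    velocity is available only in a given one, so a member of the class has to be produced.\<close>
  have "c \<noteq> {}"
    using assms(2) conformal_class_nonempty[of A c M]
    by (auto simp: almost_riemannian_def almost_pseudo_riemannian_def manifold_with_boundary_def)
  then obtain g where "g \<in> c" by blast
  interpret conformal_chart_curve M \<phi> g J \<gamma> c \<sigma>
    using conformal_chart_curveI assms(2,3) t(1) \<open>g \<in> c\<close> .
  have "t \<in> T" using t by (simp add: T_def)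
  then show "velocity \<phi> J \<gamma> t \<bullet> (conf_metric c \<phi> (\<gamma> t) *v velocity \<phi> J \<gamma> t) \<noteq> 0"
    using sigma_u_pos unfolding sigma_u_def by fastforce
next
  fix \<phi> g t i assume t: "\<phi> \<in> A" "g \<in> c" "t \<in> J" "\<gamma> t \<in> dom \<phi>"
  interpret conformal_chart_curve M \<phi> g J \<gamma> c \<sigma>
    using conformal_chart_curveI assms(2,3) t(1,2) .
  let ?D = "{t \<in> J. \<gamma> t \<notin> zero_locus M A \<sigma>}"
  have \<sigma>: "density_section A 1 \<sigma>"
    using assms(2) by (simp add: almost_riemannian_def almost_pseudo_riemannian_def)
  have "\<exists>r. W s = r *\<^sub>R u_flat s" if s: "s \<in> T" "s \<in> ?D" for s
  proof -
    have M: "\<gamma> s \<in> topspace M"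
      using cont T_D(1)[OF s(1)] by (auto simp: continuous_map_def)
    with s have "\<sigma> \<phi> (\<gamma> s) \<noteq> 0"
      using zero_locus_iff[OF \<sigma> t(1)] T_D(2) by auto
    moreover obtain k where "acceleration (singular_metric c \<sigma>) \<phi> J \<gamma> s = k *\<^sub>R u s"
      using assms(5) s M t(1) T_D unfolding unparam_geodesic_on_def by blast
    ultimately show ?thesis by (rule W_parallel_off_zero_locus[OF s(1)])
  qed
  moreover have "t \<in> T" using t by (simp add: T_def)
  ultimately obtain r where "W t = r *\<^sub>R u_flat t"
    using W_parallel[of ?D t] assms(4) by blast
  with \<open>t \<in> T\<close> show "wedge_I_Sigma c \<sigma> g \<phi> J \<gamma> t i = 0"
    by (rule wedge_I_Sigma_zero)
qed

end
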